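(* Let $K$ be a field and let $H=(H^0,H^1,s,r)$ be a hypergraph for which there is an $h\in H^1$ such that $|s(h)|\geq 2$ and $|r(h)|\geq 2$. Then $\dim_K(L_K(H))=\infty$, $L_K(H)$ is not simple (in fact it has infinitely many ideals), it is neither left nor right Artinian, and it is not von Neumann regular.
   Context: Algebras are associative but not necessarily unital; ideal means two-sided ideal. A multiset over a set $Y$ is a function $M:Y\to\mathbb N_0$; its support is $M_{\mathrm{supp}}=\{y\in Y\mid M(y)>0\}$. $\mathrm{Mult}(Y)$ is the set of multisets over $Y$ with finite, nonempty support, and $|M|=\sum_{y\in M_{\mathrm{supp}}}M(y)$. A (directed) hypergraph is a quadruple $H=(H^0,H^1,s,r)$ where $H^0,H^1$ are sets and $s,r:H^1\to\mathrm{Mult}(H^0)$ are maps. For each $h\in H^1$ fix listings with multiplicity $s(h)=\{s(h)_1,\dots,s(h)_{|s(h)|}\}$ and $r(h)=\{r(h)_1,\dots,r(h)_{|r(h)|}\}$. The Leavitt path algebra $L_K(H)$ is the (not necessarily unital) $K$-algebra presented by the generators $v,h_{ij},h_{ij}^*$ ($v\in H^0$, $h\in H^1$, $1\le i\le|s(h)|$, $1\le j\le|r(h)|$) and the relations: (i) $uv=\delta_{uv}u$ ($u,v\in H^0$); (ii) $s(h)_ih_{ij}=h_{ij}=h_{ij}r(h)_j$ and $r(h)_jh_{ij}^*=h_{ij}^*=h_{ij}^*s(h)_i$ for all $h,i,j$; (iii) $\sum_{k=1}^{|r(h)|}h_{ik}h_{jk}^*=\delta_{ij}s(h)_i$ ($h\in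 H^1$, $1\le i,j\le|s(h)|$); (iv) $\sum_{k=1}^{|s(h)|}h_{ki}^*h_{kj}=\delta_{ij}r(h)_i$ ($h\in H^1$, $1\le i,j\le|r(h)|$). A ring $R$ is von Neumann regular if for any $x\in R$ there is a $y\in R$ such that $xyx=x$. *)

theory Defs
  imports
    "HOL-Library.Multiset"
    "HOL-Algebra.QuotRing"
    "HOL-Algebra.Module"
    "Jordan_Normal_Form.Missing_VectorSpace"
begin

section \<open>Algebras over a field, not necessarily unital\<close>

text \<open>
  Algebras over a field \<open>K\<close> are carried by the record type \<open>('k, 'a) module\<close>.
  Its field \<open>one\<close> has no meaning here, since algebras need not be unital; it is never used
  and is left \<open>undefined\<close> in the algebras constructed below.
  One-sided and two-sided ideals are \<open>K\<close>-subspaces.  In a Leavitt path algebra of a hypergraph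
  this agrees with ring ideals, because such an algebra has local units.
\<close>

definition left_alg_ideal ::
    "('k, 'm) ring_scheme \<Rightarrow> ('k, 'a, 'n) module_scheme \<Rightarrow> 'a set \<Rightarrow> bool" where
  "left_alg_ideal K A J \<longleftrightarrow>
     subspace K J A \<and> (\<forall>a \<in> carrier A. \<forall>x \<in> J. a \<otimes>\<^bsub>A\<^esub> x \<in> J)"

definition right_alg_ideal ::
    "('k, 'm) ring_scheme \<Rightarrow> ('k, 'a, 'n) module_scheme \<Rightarrow> 'a set \<Rightarrow> bool" where
  "right_alg_ideal K A J \<longleftrightarrow>
     subspace K J A \<and> (\<forall>a \<in> carrier A. \<forall>x \<in> J. x \<otimes>\<^bsub>A\<^esub> a \<in> J)"

definition alg_ideal ::
    "('k, 'm) ring_scheme \<Rightarrow> ('k, 'a, 'n) module_scheme \<Rightarrow> 'a set \<Rightarrow> bool" where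
  "alg_ideal K A J \<longleftrightarrow> left_alg_ideal K A J \<and> right_alg_ideal K A J"

definition gen_alg_ideal ::
    "('k, 'm) ring_scheme \<Rightarrow> ('k, 'a, 'n) module_scheme \<Rightarrow> 'a set \<Rightarrow> 'a set" where
  "gen_alg_ideal K A S = \<Inter>{J. alg_ideal K A J \<and> S \<subseteq> J}"

definition simple_alg ::
    "('k, 'm) ring_scheme \<Rightarrow> ('k, 'a, 'n) module_scheme \<Rightarrow> bool" where
  "simple_alg K A \<longleftrightarrow>
     (\<exists>x \<in> carrier A. \<exists>y \<in> carrier A. x \<otimes>\<^bsub>A\<^esub> y \<noteq> \<zero>\<^bsub>A\<^esub>) \<and>
     (\<forall>J. alg_ideal K A J \<longrightarrow> J = {\<zero>\<^bsub>A\<^esub>} \<or> J = carrier A)"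

definition left_artinian_alg ::
    "('k, 'm) ring_scheme \<Rightarrow> ('k, 'a, 'n) module_scheme \<Rightarrow> bool" where
  "left_artinian_alg K A \<longleftrightarrow>
     (\<forall>J :: nat \<Rightarrow> 'a set.
        (\<forall>n. left_alg_ideal K A (J n)) \<and> (\<forall>n. J (Suc n) \<subseteq> J n) \<longrightarrow>
        (\<exists>N. \<forall>n \<ge> N. J n = J N))"

definition right_artinian_alg ::
    "('k, 'm) ring_scheme \<Rightarrow> ('k, 'a, 'n) module_scheme \<Rightarrow> bool" where
  "right_artinian_alg K A \<longleftrightarrow>
     (\<forall>J :: nat \<Rightarrow> 'a set.
        (\<forall>n. right_alg_ideal K A (J n)) \<and> (\<forall>n. J (Suc n) \<subseteq> J n) \<longrightarrow>
        (\<exists>N. \<forall>n \<ge> N. J n = J N))"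

definition von_neumann_regular :: "('a, 'm) ring_scheme \<Rightarrow> bool" where
  "von_neumann_regular R \<longleftrightarrow>
     (\<forall>x \<in> carrier R. \<exists>y \<in> carrier R. x \<otimes>\<^bsub>R\<^esub> y \<otimes>\<^bsub>R\<^esub> x = x)"

definition quotient_alg :: "('k, 'a, 'n) module_scheme \<Rightarrow> 'a set \<Rightarrow> ('k, 'a set) module" where
  "quotient_alg A I =
     \<lparr>carrier = a_rcosets\<^bsub>A\<^esub> I, mult = rcoset_mult A I, one = undefined, zero = I,
      add = set_add A, smult = (\<lambda>a X. \<Union>x \<in> X. I +>\<^bsub>A\<^esub> (a \<odot>\<^bsub>A\<^esub> x))\<rparr>"

text \<open>
  The free non-unital associative algebra on a set \<open>X\<close>: finitely supported functions on the nonempty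
  words over \<open>X\<close>, with convolution along concatenation as product.
\<close>

definition free_alg :: "('k, 'm) ring_scheme \<Rightarrow> 'x set \<Rightarrow> ('k, 'x list \<Rightarrow> 'k) module" where
  "free_alg K X =
     \<lparr>carrier = {f. (\<forall>w. f w \<in> carrier K) \<and> finite {w. f w \<noteq> \<zero>\<^bsub>K\<^esub>} \<and>
                    {w. f w \<noteq> \<zero>\<^bsub>K\<^esub>} \<subseteq> lists X - {[]}},
      mult = (\<lambda>f g w. \<Oplus>\<^bsub>K\<^esub> i \<in> {..length w}. f (take i w) \<otimes>\<^bsub>K\<^esub> g (drop i w)),
      one = undefined,
      zero = (\<lambda>w. \<zero>\<^bsub>K\<^esub>),
      add = (\<lambda>f g w. f w \<oplus>\<^bsub>K\<^esub> g w),
      smult = (\<lambda>a f w. a \<otimes>\<^bsub>K\<^esub> f w)\<rparr>"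

definition free_gen :: "('k, 'm) ring_scheme \<Rightarrow> 'x \<Rightarrow> 'x list \<Rightarrow> 'k" where
  "free_gen K x = (\<lambda>w. if w = [x] then \<one>\<^bsub>K\<^esub> else \<zero>\<^bsub>K\<^esub>)"

text \<open>The algebra presented by generators \<open>X\<close> and relations \<open>l = r\<close> for \<open>(l, r) \<in> R\<close>.\<close>

definition presented_alg ::
    "('k, 'm) ring_scheme \<Rightarrow> 'x set \<Rightarrow> (('x list \<Rightarrow> 'k) \<times> ('x list \<Rightarrow> 'k)) set
     \<Rightarrow> ('k, ('x list \<Rightarrow> 'k) set) module" where
  "presented_alg K X R =
     quotient_alg (free_alg K X)
       (gen_alg_ideal K (free_alg K X) {l \<ominus>\<^bsub>free_alg K X\<^esub> r | l r. (l, r) \<in> R})"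


section \<open>Hypergraphs and their Leavitt path algebras\<close>

record ('v, 'e) pre_hypergraph =
  hverts :: "'v set"
  hedges :: "'e set"
  hsource :: "'e \<Rightarrow> 'v multiset"
  hrange :: "'e \<Rightarrow> 'v multiset"

locale hypergraph =
  fixes H :: "('v, 'e) pre_hypergraph"
  assumes source_nonempty: "h \<in> hedges H \<Longrightarrow> hsource H h \<noteq> {#}"
    and source_verts: "h \<in> hedges H \<Longrightarrow> set_mset (hsource H h) \<subseteq> hverts H"
    and range_nonempty: "h \<in> hedges H \<Longrightarrow> hrange H h \<noteq> {#}"
    and range_verts: "h \<in> hedges H \<Longrightarrow> set_mset (hrange H h) \<subseteq> hverts H"

text \<open>
  \<open>sl h\<close> and \<open>rl h\<close> list the source and the range of \<open>h\<close> with multiplicity.  All indices into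
  these listings start at 0.
\<close>

definition hypergraph_listing ::
    "('v, 'e) pre_hypergraph \<Rightarrow> ('e \<Rightarrow> 'v list) \<Rightarrow> ('e \<Rightarrow> 'v list) \<Rightarrow> bool" where
  "hypergraph_listing H sl rl \<longleftrightarrow>
     (\<forall>h \<in> hedges H. mset (sl h) = hsource H h \<and> mset (rl h) = hrange H h)"

text \<open>\<open>Vert v\<close>, \<open>Edge h i j\<close> and \<open>Ghost h i j\<close> stand for $v$, $h_{ij}$ and $h_{ij}^*$.\<close>

datatype ('v, 'e) lpa_gen = Vert 'v | Edge 'e nat nat | Ghost 'e nat nat

definition lpa_gens :: "('v, 'e) pre_hypergraph \<Rightarrow> ('v, 'e) lpa_gen set" where
  "lpa_gens H =
     {Vert v | v. v \<in> hverts H} \<union>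
     {Edge h i j | h i j. h \<in> hedges H \<and> i < size (hsource H h) \<and> j < size (hrange H h)} \<union>
     {Ghost h i j | h i j. h \<in> hedges H \<and> i < size (hsource H h) \<and> j < size (hrange H h)}"

inductive_set lpa_rels ::
    "('k, 'm) ring_scheme \<Rightarrow> ('v, 'e) pre_hypergraph \<Rightarrow> ('e \<Rightarrow> 'v list) \<Rightarrow> ('e \<Rightarrow> 'v list) \<Rightarrow>
     ((('v, 'e) lpa_gen list \<Rightarrow> 'k) \<times> (('v, 'e) lpa_gen list \<Rightarrow> 'k)) set"
  for K :: "('k, 'm) ring_scheme" and H :: "('v, 'e) pre_hypergraph"
    and sl :: "'e \<Rightarrow> 'v list" and rl :: "'e \<Rightarrow> 'v list" where
  vertices:
    "u \<in> hverts H \<Longrightarrow> v \<in> hverts H \<Longrightarrow>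
     (free_gen K (Vert u) \<otimes>\<^bsub>free_alg K (lpa_gens H)\<^esub> free_gen K (Vert v),
      if u = v then free_gen K (Vert u) else \<zero>\<^bsub>free_alg K (lpa_gens H)\<^esub>) \<in> lpa_rels K H sl rl"
| source_edge:
    "h \<in> hedges H \<Longrightarrow> i < size (hsource H h) \<Longrightarrow> j < size (hrange H h) \<Longrightarrow>
     (free_gen K (Vert (sl h ! i)) \<otimes>\<^bsub>free_alg K (lpa_gens H)\<^esub> free_gen K (Edge h i j),
      free_gen K (Edge h i j)) \<in> lpa_rels K H sl rl"
| edge_range:
    "h \<in> hedges H \<Longrightarrow> i < size (hsource H h) \<Longrightarrow> j < size (hrange H h) \<Longrightarrow>
     (free_gen K (Edge h i j) \<otimes>\<^bsub>free_alg K (lpa_gens H)\<^esub> free_gen K (Vert (rl h ! j)),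
      free_gen K (Edge h i j)) \<in> lpa_rels K H sl rl"
| range_ghost:
    "h \<in> hedges H \<Longrightarrow> i < size (hsource H h) \<Longrightarrow> j < size (hrange H h) \<Longrightarrow>
     (free_gen K (Vert (rl h ! j)) \<otimes>\<^bsub>free_alg K (lpa_gens H)\<^esub> free_gen K (Ghost h i j),
      free_gen K (Ghost h i j)) \<in> lpa_rels K H sl rl"
| ghost_source:
    "h \<in> hedges H \<Longrightarrow> i < size (hsource H h) \<Longrightarrow> j < size (hrange H h) \<Longrightarrow>
     (free_gen K (Ghost h i j) \<otimes>\<^bsub>free_alg K (lpa_gens H)\<^esub> free_gen K (Vert (sl h ! i)),
      free_gen K (Ghost h i j)) \<in> lpa_rels K H sl rl"
| edge_ghost:
    "h \<in> hedges H \<Longrightarrow> i < size (hsource H h) \<Longrightarrow> j < size (hsource H h) \<Longrightarrow>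
     (\<Oplus>\<^bsub>free_alg K (lpa_gens H)\<^esub> k \<in> {..<size (hrange H h)}.
        free_gen K (Edge h i k) \<otimes>\<^bsub>free_alg K (lpa_gens H)\<^esub> free_gen K (Ghost h j k),
      if i = j then free_gen K (Vert (sl h ! i)) else \<zero>\<^bsub>free_alg K (lpa_gens H)\<^esub>)
     \<in> lpa_rels K H sl rl"
| ghost_edge:
    "h \<in> hedges H \<Longrightarrow> i < size (hrange H h) \<Longrightarrow> j < size (hrange H h) \<Longrightarrow>
     (\<Oplus>\<^bsub>free_alg K (lpa_gens H)\<^esub> k \<in> {..<size (hsource H h)}.
        free_gen K (Ghost h k i) \<otimes>\<^bsub>free_alg K (lpa_gens H)\<^esub> free_gen K (Edge h k j),
      if i = j then free_gen K (Vert (rl h ! i)) else \<zero>\<^bsub>free_alg K (lpa_gens H)\<^esub>)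
     \<in> lpa_rels K H sl rl"

definition leavitt_path_alg ::
    "('k, 'm) ring_scheme \<Rightarrow> ('v, 'e) pre_hypergraph \<Rightarrow> ('e \<Rightarrow> 'v list) \<Rightarrow> ('e \<Rightarrow> 'v list) \<Rightarrow>
     ('k, (('v, 'e) lpa_gen list \<Rightarrow> 'k) set) module" where
  "leavitt_path_alg K H sl rl = presented_alg K (lpa_gens H) (lpa_rels K H sl rl)"

end

theory Submission
  imports Defs "HOL-Library.Countable_Set"
begin

text \<open>
  Let \<open>V\<close> be the space of sequences over the ring of formal power series in \<open>t\<close>.  A module over the
  Leavitt path algebra arises from a copy of \<open>V\<close> at every vertex and, for every hyperedge \<open>h\<close>, an
  isomorphism between the direct sum of the copies at the range of \<open>h\<close> and that of the copies at the
  source; such isomorphisms always exist, as all these sums are isomorphic to \<open>V\<close>.  The distinguished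
  hyperedge has at least two sources and two ranges, which leaves room to twist its isomorphism by
  an invertible matrix in such a way that $p = h_{22} h_{22}^*$ acts as \<open>t\<close> times a coordinate projection.
  All generators preserve the submodules $t^n V$, so the elements mapping the whole module into its
  multiple by $t^n$ form an ideal $J_n$, and $p^n$ lies in $J_n$ but not in $J_{n+1}$.  The chain of the
  $J_n$ refutes everything but regularity, and $p y p \in J_2$ for every \<open>y\<close>, whereas $p \notin J_2$.
\<close>

section \<open>Filtered operators\<close>

text \<open>With a single source, the relations \<open>ghost_edge\<close> read h_1i^* h_1j =
  \<delta>_ij r(h)_i, so every h_1j h_1j^* is idempotent; with a single range,
  \<open>edge_ghost\<close> makes h_i1 h_i1^* a vertex. From size two on, h_22 h_22^* can be far
  from idempotent. Over a commutative ring, a matrix with rows (a, b), (c, d) and determinant 1 has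
  lower right entry d, and its inverse has lower right entry a. So p becomes ad, subject only to ad
  - bc = 1; the choice a = b = 1, d = t, c = t - 1 gives p = t. The module replaces normal forms in
  the presented algebra: separating two elements takes only an evaluation at one vector. Sequence
  spaces are chosen because the numbers of sources and ranges of the other hyperedges are arbitrary:
  finite-rank copies would impose numerical constraints on the ranks, whereas countably many
  coordinates can be divided into any positive number of infinite blocks.\<close>

text \<open>A function of \<open>(i, e)\<close> is a family of power series in \<open>t\<close>, with \<open>e\<close> the exponent;
  \<open>filt K n\<close> consists of the families divisible by $t^n$.\<close>

definition filt :: "('k, 'm) ring_scheme \<Rightarrow> nat \<Rightarrow> ('i \<times> nat \<Rightarrow> 'k) set" where
  "filt K n = {\<psi>. \<forall>i e. \<psi> (i, e) \<in> carrier K \<and> (e < n \<longrightarrow> \<psi> (i, e) = \<zero>\<^bsub>K\<^esub>)}"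

text \<open>Linearity is asked for on \<open>filt K 0\<close> alone, since elsewhere values may
  leave the carrier of \<open>K\<close>, where ring laws say nothing. Source and target have
  separate index types because later operators pass between vertices and positions in a
  listing.\<close>

definition filt_op ::
    "('k, 'm) ring_scheme \<Rightarrow> (('i \<times> nat \<Rightarrow> 'k) \<Rightarrow> ('j \<times> nat \<Rightarrow> 'k)) \<Rightarrow> bool" where
  "filt_op K A \<longleftrightarrow>
     (\<forall>n. \<forall>\<psi> \<in> filt K n. A \<psi> \<in> filt K n) \<and>
     (\<forall>\<psi> \<in> filt K 0. \<forall>\<phi> \<in> filt K 0. A (\<lambda>x. \<psi> x \<oplus>\<^bsub>K\<^esub> \<phi> x) = (\<lambda>x. A \<psi> x \<oplus>\<^bsub>K\<^esub> A \<phi> x)) \<and>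
     (\<forall>c \<in> carrier K. \<forall>\<psi> \<in> filt K 0. A (\<lambda>x. c \<otimes>\<^bsub>K\<^esub> \<psi> x) = (\<lambda>x. c \<otimes>\<^bsub>K\<^esub> A \<psi> x))"

text \<open>\<open>foldr\<close> lets the first letter act last, which turns concatenation of words
  into composition and makes this a left action.\<close>

definition word_sum ::
    "('k, 'm) ring_scheme \<Rightarrow> ('x \<Rightarrow> ('i \<Rightarrow> 'k) \<Rightarrow> ('i \<Rightarrow> 'k)) \<Rightarrow> ('x list \<Rightarrow> 'k) \<Rightarrow> ('i \<Rightarrow> 'k) \<Rightarrow> 'i \<Rightarrow> 'k" where
  "word_sum K T f \<psi> x = (\<Oplus>\<^bsub>K\<^esub> w \<in> {w. f w \<noteq> \<zero>\<^bsub>K\<^esub>}. f w \<otimes>\<^bsub>K\<^esub> foldr T w \<psi> x)"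

lemma filt_carrier: "\<psi> \<in> filt K n \<Longrightarrow> \<psi> x \<in> carrier K"
  by (cases x) (simp add: filt_def)

lemma filt_zero: "\<psi> \<in> filt K n \<Longrightarrow> e < n \<Longrightarrow> \<psi> (i, e) = \<zero>\<^bsub>K\<^esub>"
  by (simp add: filt_def)

lemma filtI:
  "(\<And>i e. \<psi> (i, e) \<in> carrier K) \<Longrightarrow> (\<And>i e. e < n \<Longrightarrow> \<psi> (i, e) = \<zero>\<^bsub>K\<^esub>) \<Longrightarrow> \<psi> \<in> filt K n"
  by (simp add: filt_def)

lemma filt_mono: "m \<le> n \<Longrightarrow> filt K n \<subseteq> filt K m"
  by (auto simp: filt_def)

lemma filt_opI:
  assumes "\<And>n \<psi>. \<psi> \<in> filt K n \<Longrightarrow> A \<psi> \<in> filt K n"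
    and "\<And>\<psi> \<phi> x. \<psi> \<in> filt K 0 \<Longrightarrow> \<phi> \<in> filt K 0 \<Longrightarrow> A (\<lambda>x. \<psi> x \<oplus>\<^bsub>K\<^esub> \<phi> x) x = A \<psi> x \<oplus>\<^bsub>K\<^esub> A \<phi> x"
    and "\<And>c \<psi> x. c \<in> carrier K \<Longrightarrow> \<psi> \<in> filt K 0 \<Longrightarrow> A (\<lambda>x. c \<otimes>\<^bsub>K\<^esub> \<psi> x) x = c \<otimes>\<^bsub>K\<^esub> A \<psi> x"
  shows "filt_op K A"
  using assms unfolding filt_op_def by blast

lemma filt_op_closed: "filt_op K A \<Longrightarrow> \<psi> \<in> filt K n \<Longrightarrow> A \<psi> \<in> filt K n"
  by (simp add: filt_op_def)

lemma filt_op_add: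
  "filt_op K A \<Longrightarrow> \<psi> \<in> filt K 0 \<Longrightarrow> \<phi> \<in> filt K 0 \<Longrightarrow>
    A (\<lambda>x. \<psi> x \<oplus>\<^bsub>K\<^esub> \<phi> x) = (\<lambda>x. A \<psi> x \<oplus>\<^bsub>K\<^esub> A \<phi> x)"
  by (simp add: filt_op_def)

lemma filt_op_smult:
  "filt_op K A \<Longrightarrow> c \<in> carrier K \<Longrightarrow> \<psi> \<in> filt K 0 \<Longrightarrow>
    A (\<lambda>x. c \<otimes>\<^bsub>K\<^esub> \<psi> x) = (\<lambda>x. c \<otimes>\<^bsub>K\<^esub> A \<psi> x)"
  by (simp add: filt_op_def)

lemma filt_op_comp:
  assumes "filt_op K A" "filt_op K B"
  shows "filt_op K (\<lambda>\<psi>. A (B \<psi>))"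
  using assms unfolding filt_op_def by simp

lemma filt_op_foldr:
  assumes "\<And>x. x \<in> set w \<Longrightarrow> filt_op K (T x)"
  shows "filt_op K (foldr T w)"
  using assms
proof (induction w)
  case Nil
  then show ?case by (simp add: filt_op_def)
next
  case (Cons x w)
  then have "filt_op K (\<lambda>\<psi>. T x (foldr T w \<psi>))"
    using filt_op_comp[of K "T x" "foldr T w"] by simp
  then show ?case by (simp add: comp_def)
qed

context cring
begin

lemma finsum_filt:
  assumes "\<And>w. w \<in> W \<Longrightarrow> g w \<in> filt R n"
  shows "(\<lambda>x. \<Oplus>w \<in> W. g w x) \<in> filt R n"
proof (rule filtI)
  show "(\<Oplus>w \<in> W. g w (i, e)) \<in> carrier R" for i e
    using assms by (intro finsum_closed funcsetI) (rule filt_carrier[where n = n])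
  show "(\<Oplus>w \<in> W. g w (i, e)) = \<zero>" if "e < n" for i e
    using assms that by (auto intro!: add.finprod_one_eqI filt_zero[of _ _ n])
qed

lemma filt_op_finsum:
  assumes A: "filt_op R A" and "finite W" "\<And>w. w \<in> W \<Longrightarrow> g w \<in> filt R 0"
  shows "A (\<lambda>x. \<Oplus>w \<in> W. g w x) = (\<lambda>x. \<Oplus>w \<in> W. A (g w) x)"
  using assms(2,3)
proof (induction W)
  case empty
  have z: "(\<lambda>_. \<zero>) \<in> filt R 0" by (simp add: filt_def)
  \<comment> \<open>The zero function is 0 times itself, so homogeneity yields A 0 = 0.\<close>
  have "A (\<lambda>x. \<zero> \<otimes> (\<lambda>_. \<zero>) x) = (\<lambda>x. \<zero> \<otimes> A (\<lambda>_. \<zero>) x)"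
    by (rule filt_op_smult[OF A zero_closed z])
  then show ?case
    using filt_carrier[OF filt_op_closed[OF A z]] by simp
next
  case (insert w W)
  have s: "(\<lambda>x. \<Oplus>w \<in> W. g w x) \<in> filt R 0"
    using insert by (intro finsum_filt) auto
  have c: "(\<lambda>w. g w x) \<in> W \<rightarrow> carrier R" "g w x \<in> carrier R" for x
    using insert by (auto intro: filt_carrier[of _ _ 0])
  have c': "(\<lambda>w. A (g w) x) \<in> W \<rightarrow> carrier R" "A (g w) x \<in> carrier R" for x
    using insert by (auto intro!: filt_carrier[of _ _ 0] filt_op_closed[OF A])
  have "A (\<lambda>x. \<Oplus>w \<in> insert w W. g w x) = A (\<lambda>x. g w x \<oplus> (\<Oplus>w \<in> W. g w x))"
    using insert c by simp
  also have "\<dots> = (\<lambda>x. A (g w) x \<oplus> A (\<lambda>x. \<Oplus>w \<in> W. g w x) x)"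
    using s insert.prems by (intro filt_op_add[OF A]) auto
  finally show ?case
    using insert c' by simp
qed

section \<open>The free algebra\<close>

lemma free_alg_simps:
  "f \<in> carrier (free_alg R X) \<longleftrightarrow>
     (\<forall>w. f w \<in> carrier R) \<and> finite {w. f w \<noteq> \<zero>} \<and> {w. f w \<noteq> \<zero>} \<subseteq> lists X - {[]}"
  "(f \<otimes>\<^bsub>free_alg R X\<^esub> g) w = (\<Oplus>i \<in> {..length w}. f (take i w) \<otimes> g (drop i w))"
  "\<zero>\<^bsub>free_alg R X\<^esub> = (\<lambda>w. \<zero>)"
  "f \<oplus>\<^bsub>free_alg R X\<^esub> g = (\<lambda>w. f w \<oplus> g w)"
  "a \<odot>\<^bsub>free_alg R X\<^esub> f = (\<lambda>w. a \<otimes> f w)"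
  by (simp_all add: free_alg_def)

lemma free_alg_carrier: "f \<in> carrier (free_alg R X) \<Longrightarrow> f w \<in> carrier R"
  by (simp add: free_alg_simps)

lemma free_alg_add_closed:
  assumes "f \<in> carrier (free_alg R X)" "g \<in> carrier (free_alg R X)"
  shows "f \<oplus>\<^bsub>free_alg R X\<^esub> g \<in> carrier (free_alg R X)"
proof -
  have "{w. f w \<oplus> g w \<noteq> \<zero>} \<subseteq> {w. f w \<noteq> \<zero>} \<union> {w. g w \<noteq> \<zero>}"
    by auto
  with assms show ?thesis
    unfolding free_alg_simps by (blast intro: finite_subset)
qed

lemma free_alg_smult_closed:
  assumes "a \<in> carrier R" "f \<in> carrier (free_alg R X)"
  shows "a \<odot>\<^bsub>free_alg R X\<^esub> f \<in> carrier (free_alg R X)"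
proof -
  have "{w. a \<otimes> f w \<noteq> \<zero>} \<subseteq> {w. f w \<noteq> \<zero>}"
    using assms by auto
  with assms show ?thesis
    unfolding free_alg_simps by (blast intro: finite_subset)
qed

lemma free_alg_abelian_group: "abelian_group (free_alg R X)"
proof (rule abelian_groupI)
  fix f assume f: "f \<in> carrier (free_alg R X)"
  have "(\<lambda>w. \<ominus> f w) \<oplus>\<^bsub>free_alg R X\<^esub> f = \<zero>\<^bsub>free_alg R X\<^esub>"
    using f by (auto simp: free_alg_simps l_neg)
  moreover have "{w. \<ominus> f w \<noteq> \<zero>} \<subseteq> {w. f w \<noteq> \<zero>}"
    by auto
  then have "(\<lambda>w. \<ominus> f w) \<in> carrier (free_alg R X)"
    using f unfolding free_alg_simps by (blast intro: finite_subset)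
  ultimately show "\<exists>g \<in> carrier (free_alg R X). g \<oplus>\<^bsub>free_alg R X\<^esub> f = \<zero>\<^bsub>free_alg R X\<^esub>"
    by blast
next
  fix f g assume "f \<in> carrier (free_alg R X)" "g \<in> carrier (free_alg R X)"
  then show "f \<oplus>\<^bsub>free_alg R X\<^esub> g = g \<oplus>\<^bsub>free_alg R X\<^esub> f"
    unfolding free_alg_simps(4) by (intro ext a_comm free_alg_carrier)
next
  fix f g h
  assume "f \<in> carrier (free_alg R X)" "g \<in> carrier (free_alg R X)" "h \<in> carrier (free_alg R X)"
  then show "f \<oplus>\<^bsub>free_alg R X\<^esub> g \<oplus>\<^bsub>free_alg R X\<^esub> h = f \<oplus>\<^bsub>free_alg R X\<^esub> (g \<oplus>\<^bsub>free_alg R X\<^esub> h)"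
    unfolding free_alg_simps(4) by (intro ext a_assoc free_alg_carrier)
next
  fix f assume "f \<in> carrier (free_alg R X)"
  then show "\<zero>\<^bsub>free_alg R X\<^esub> \<oplus>\<^bsub>free_alg R X\<^esub> f = f"
    unfolding free_alg_simps(3,4) by (intro ext l_zero free_alg_carrier)
next
  show "\<zero>\<^bsub>free_alg R X\<^esub> \<in> carrier (free_alg R X)"
    by (simp add: free_alg_simps)
qed (rule free_alg_add_closed)

lemma free_alg_module: "module R (free_alg R X)"
proof (rule moduleI)
  show "cring R" ..
  show "abelian_group (free_alg R X)"
    by (rule free_alg_abelian_group)
next
  fix a f assume "a \<in> carrier R" "f \<in> carrier (free_alg R X)"
  then show "a \<odot>\<^bsub>free_alg R X\<^esub> f \<in> carrier (free_alg R X)"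
    by (rule free_alg_smult_closed)
next
  fix a b f assume "a \<in> carrier R" "b \<in> carrier R" "f \<in> carrier (free_alg R X)"
  then show "(a \<oplus> b) \<odot>\<^bsub>free_alg R X\<^esub> f = a \<odot>\<^bsub>free_alg R X\<^esub> f \<oplus>\<^bsub>free_alg R X\<^esub> b \<odot>\<^bsub>free_alg R X\<^esub> f"
    unfolding free_alg_simps(4,5) by (simp add: l_distr free_alg_carrier[where X = X])
next
  fix a f g assume "a \<in> carrier R" "f \<in> carrier (free_alg R X)" "g \<in> carrier (free_alg R X)"
  then show "a \<odot>\<^bsub>free_alg R X\<^esub> (f \<oplus>\<^bsub>free_alg R X\<^esub> g) =
      a \<odot>\<^bsub>free_alg R X\<^esub> f \<oplus>\<^bsub>free_alg R X\<^esub> a \<odot>\<^bsub>free_alg R X\<^esub> g"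
    unfolding free_alg_simps(4,5) by (simp add: r_distr free_alg_carrier[where X = X])
next
  fix a b f assume "a \<in> carrier R" "b \<in> carrier R" "f \<in> carrier (free_alg R X)"
  then show "(a \<otimes> b) \<odot>\<^bsub>free_alg R X\<^esub> f = a \<odot>\<^bsub>free_alg R X\<^esub> (b \<odot>\<^bsub>free_alg R X\<^esub> f)"
    unfolding free_alg_simps(5) by (simp add: m_assoc free_alg_carrier[where X = X])
next
  fix f assume "f \<in> carrier (free_alg R X)"
  then show "\<one> \<odot>\<^bsub>free_alg R X\<^esub> f = f"
    unfolding free_alg_simps(5) by (simp add: l_one free_alg_carrier[where X = X])
qed

text \<open>Unlike the definition, the right-hand side has an index set that does not depend on \<open>w\<close>, so
  sums over words can be interchanged with it.\<close>

lemma free_alg_mult_conv: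
  assumes f: "\<And>w. f w \<in> carrier R" and g: "\<And>w. g w \<in> carrier R"
    and U: "finite U" "{w. f w \<noteq> \<zero>} \<subseteq> U" and V: "finite V" "{w. g w \<noteq> \<zero>} \<subseteq> V"
  shows "(f \<otimes>\<^bsub>free_alg R X\<^esub> g) w = (\<Oplus>u \<in> U. \<Oplus>v \<in> V. if u @ v = w then f u \<otimes> g v else \<zero>)"
proof -
  \<comment> \<open>Once the prefix \<open>u\<close> is given, \<open>w\<close> leaves a single
    candidate for the second factor, so the inner sum has at most one nonzero term.\<close>
  let ?h = "\<lambda>u. if take (length u) w = u then f u \<otimes> g (drop (length u) w) else \<zero>"
  have inner: "(\<Oplus>v \<in> V. if u @ v = w then f u \<otimes> g v else \<zero>) = ?h u" for u
  proof (cases "take (length u) w = u")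
    case False
    then have "u @ v \<noteq> w" for v by auto
    then show ?thesis using False by simp
  next
    case True
    then have eq: "u @ v = w \<longleftrightarrow> v = drop (length u) w" for v
      by (metis append_eq_conv_conj append_take_drop_id)
    \<comment> \<open>The suffix may lie outside \<open>V\<close>. Adding it changes nothing, as
      \<open>g\<close> vanishes there, and makes the rule for one-term sums applicable.\<close>
    have "(\<Oplus>v \<in> V. if u @ v = w then f u \<otimes> g v else \<zero>) =
        (\<Oplus>v \<in> insert (drop (length u) w) V. if v = drop (length u) w then f u \<otimes> g v else \<zero>)"
      unfolding eq
    proof (rule add.finprod_mono_neutral_cong_left)
      fix v assume "v \<in> insert (drop (length u) w) V - V"
      then have "g v = \<zero>" using V by auto
      then show "(if v = drop (length u) w then f u \<otimes> g v else \<zero>) = \<zero>"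
        using f by auto
    qed (use V f g in auto)
    also have "\<dots> = f u \<otimes> g (drop (length u) w)"
      using V f g by (intro add.finprod_singleton_swap) auto
    finally show ?thesis using True by simp
  qed
  \<comment> \<open>A prefix of \<open>w\<close> is determined by its length, so cut positions can
    be traded for words as summation indices.\<close>
  have inj: "inj_on (\<lambda>i. take i w) {..length w}"
    by (intro inj_onI) (metis atMost_iff length_take min.absorb2)
  have "(f \<otimes>\<^bsub>free_alg R X\<^esub> g) w = (\<Oplus>i \<in> {..length w}. ?h (take i w))"
    unfolding free_alg_simps using f g by (intro finsum_cong') (auto simp: min_def)
  also have "\<dots> = (\<Oplus>u \<in> (\<lambda>i. take i w) ` {..length w}. ?h u)"
    using inj f g by (intro finsum_reindex[symmetric]) auto
  also have "\<dots> = (\<Oplus>u \<in> U. ?h u)"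
  proof (rule add.finprod_mono_neutral_cong)
    fix u assume "u \<in> U - (\<lambda>i. take i w) ` {..length w}"
    then have "take (length u) w \<noteq> u"
      by (metis DiffE atMost_iff imageI nat_le_linear take_all)
    then show "?h u = \<zero>" by simp
  next
    fix u assume "u \<in> (\<lambda>i. take i w) ` {..length w} - U"
    then have "f u = \<zero>" using U by auto
    then show "?h u = \<zero>" using g by simp
  qed (use U f g in auto)
  finally show ?thesis using inner by simp
qed

lemma free_alg_mult_closed:
  assumes f: "f \<in> carrier (free_alg R X)" and g: "g \<in> carrier (free_alg R X)"
  shows "f \<otimes>\<^bsub>free_alg R X\<^esub> g \<in> carrier (free_alg R X)"
proof -
  let ?U = "{w. f w \<noteq> \<zero>}" and ?V = "{w. g w \<noteq> \<zero>}"
  have fin: "finite ?U" "finite ?V" and sub: "?U \<subseteq> lists X - {[]}" "?V \<subseteq> lists X - {[]}"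
    using f g by (auto simp: free_alg_simps)
  have c: "f w \<in> carrier R" "g w \<in> carrier R" for w
    using f g by (auto simp: free_alg_carrier)
  have "(f \<otimes>\<^bsub>free_alg R X\<^esub> g) w = \<zero>" if "w \<notin> (\<lambda>(u, v). u @ v) ` (?U \<times> ?V)" for w
  proof -
    have "(\<Oplus>u \<in> ?U. \<Oplus>v \<in> ?V. if u @ v = w then f u \<otimes> g v else \<zero>) = \<zero>"
      using that by (intro add.finprod_one_eqI) auto
    then show ?thesis
      using free_alg_mult_conv[of f g ?U ?V] c fin by simp
  qed
  then have "{w. (f \<otimes>\<^bsub>free_alg R X\<^esub> g) w \<noteq> \<zero>} \<subseteq> (\<lambda>(u, v). u @ v) ` (?U \<times> ?V)"
    by blast
  moreover have "(\<lambda>(u, v). u @ v) ` (?U \<times> ?V) \<subseteq> lists X - {[]}"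
    using sub by fastforce
  moreover have "(f \<otimes>\<^bsub>free_alg R X\<^esub> g) w \<in> carrier R" for w
    unfolding free_alg_simps using c by auto
  ultimately show ?thesis
    unfolding free_alg_simps(1) using fin by (meson finite_SigmaI finite_imageI finite_subset subset_trans)
qed

lemma free_alg_l_distr:
  assumes "f \<in> carrier (free_alg R X)" "g \<in> carrier (free_alg R X)" "h \<in> carrier (free_alg R X)"
  shows "(f \<oplus>\<^bsub>free_alg R X\<^esub> g) \<otimes>\<^bsub>free_alg R X\<^esub> h =
    f \<otimes>\<^bsub>free_alg R X\<^esub> h \<oplus>\<^bsub>free_alg R X\<^esub> g \<otimes>\<^bsub>free_alg R X\<^esub> h"
  using assms
  by (auto simp: fun_eq_iff free_alg_simps(2,4) free_alg_carrier l_distr intro!: finsum_addf)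

lemma free_alg_r_distr:
  assumes "f \<in> carrier (free_alg R X)" "g \<in> carrier (free_alg R X)" "h \<in> carrier (free_alg R X)"
  shows "h \<otimes>\<^bsub>free_alg R X\<^esub> (f \<oplus>\<^bsub>free_alg R X\<^esub> g) =
    h \<otimes>\<^bsub>free_alg R X\<^esub> f \<oplus>\<^bsub>free_alg R X\<^esub> h \<otimes>\<^bsub>free_alg R X\<^esub> g"
  using assms
  by (auto simp: fun_eq_iff free_alg_simps(2,4) free_alg_carrier r_distr intro!: finsum_addf)

lemma free_gen_carrier: "x \<in> X \<Longrightarrow> free_gen R x \<in> carrier (free_alg R X)"
  by (auto simp: free_alg_simps free_gen_def)

end

section \<open>Actions of the free algebra\<close>

locale filtered_action = cring R for R (structure) +
  fixes X :: "'x set" and T :: "'x \<Rightarrow> ('i \<times> nat \<Rightarrow> 'a) \<Rightarrow> ('i \<times> nat \<Rightarrow> 'a)"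
  assumes filt_op_gen: "x \<in> X \<Longrightarrow> filt_op R (T x)"
begin

abbreviation F where "F \<equiv> free_alg R X"
abbreviation act where "act \<equiv> word_sum R T"

lemma filt_op_word: "w \<in> lists X \<Longrightarrow> filt_op R (foldr T w)"
  by (intro filt_op_foldr filt_op_gen) auto

lemma foldr_carrier: "w \<in> lists X \<Longrightarrow> \<psi> \<in> filt R 0 \<Longrightarrow> foldr T w \<psi> x \<in> carrier R"
  by (rule filt_carrier[OF filt_op_closed[OF filt_op_word]])

lemma filt_0: "\<psi> \<in> filt R n \<Longrightarrow> \<psi> \<in> filt R 0"
  using filt_mono by blast

text \<open>Supports can shrink by cancellation. Padding to a common finite set of words lets the
  sums for different elements be compared termwise.\<close>

lemma act_superset:
  assumes "f \<in> carrier F" "finite W" "{w. f w \<noteq> \<zero>} \<subseteq> W" "W \<subseteq> lists X" "\<psi> \<in> filt R 0"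
  shows "act f \<psi> x = (\<Oplus>w \<in> W. f w \<otimes> foldr T w \<psi> x)"
  unfolding word_sum_def
proof (rule add.finprod_mono_neutral_cong_left)
  show "f w \<otimes> foldr T w \<psi> x = \<zero>" if "w \<in> W - {w. f w \<noteq> \<zero>}" for w
    using that foldr_carrier[OF subsetD[OF assms(4)] assms(5), of w x] by simp
  show "(\<lambda>w. f w \<otimes> foldr T w \<psi> x) \<in> W \<rightarrow> carrier R"
    using assms foldr_carrier free_alg_carrier by blast
qed (use assms in auto)

lemma smult_filt: "c \<in> carrier R \<Longrightarrow> \<psi> \<in> filt R n \<Longrightarrow> (\<lambda>x. c \<otimes> \<psi> x) \<in> filt R n"
  by (auto simp: filt_def)

lemma add_filt: "\<phi> \<in> filt R n \<Longrightarrow> \<psi> \<in> filt R n \<Longrightarrow> (\<lambda>x. \<phi> x \<oplus> \<psi> x) \<in> filt R n"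
  by (auto simp: filt_def)

lemma zero_filt: "(\<lambda>x. \<zero>) \<in> filt R n"
  by (auto simp: filt_def)

lemma act_filt:
  assumes f: "f \<in> carrier F" and \<psi>: "\<psi> \<in> filt R n"
  shows "act f \<psi> \<in> filt R n"
proof -
  have "w \<in> lists X" if "f w \<noteq> \<zero>" for w
    using that f by (auto simp: free_alg_simps)
  then have "(\<lambda>x. f w \<otimes> foldr T w \<psi> x) \<in> filt R n" if "f w \<noteq> \<zero>" for w
    using that f \<psi> by (intro smult_filt filt_op_closed[OF filt_op_word] free_alg_carrier[OF f]) auto
  then have "(\<lambda>x. \<Oplus>w \<in> {w. f w \<noteq> \<zero>}. f w \<otimes> foldr T w \<psi> x) \<in> filt R n"
    by (intro finsum_filt) auto
  then show ?thesis
    by (simp add: word_sum_def[abs_def])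
qed

lemma act_add:
  assumes f: "f \<in> carrier F" and g: "g \<in> carrier F" and \<psi>: "\<psi> \<in> filt R 0"
  shows "act (f \<oplus>\<^bsub>F\<^esub> g) \<psi> x = act f \<psi> x \<oplus> act g \<psi> x"
proof -
  let ?W = "{w. f w \<noteq> \<zero>} \<union> {w. g w \<noteq> \<zero>}"
  have W: "finite ?W" "?W \<subseteq> lists X"
    using f g by (auto simp: free_alg_simps)
  have c: "f w \<in> carrier R" "g w \<in> carrier R" for w
    using f g by (auto simp: free_alg_simps)
  have t: "foldr T w \<psi> x \<in> carrier R" if "w \<in> ?W" for w
    using that W \<psi> by (intro foldr_carrier) auto
  have "{w. (f \<oplus>\<^bsub>F\<^esub> g) w \<noteq> \<zero>} \<subseteq> ?W"
    by (auto simp: free_alg_simps)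
  then have "act (f \<oplus>\<^bsub>F\<^esub> g) \<psi> x = (\<Oplus>w \<in> ?W. (f \<oplus>\<^bsub>F\<^esub> g) w \<otimes> foldr T w \<psi> x)"
    using W free_alg_add_closed[OF f g] \<psi> by (intro act_superset) auto
  also have "\<dots> = (\<Oplus>w \<in> ?W. f w \<otimes> foldr T w \<psi> x \<oplus> g w \<otimes> foldr T w \<psi> x)"
    using c t by (intro finsum_cong') (auto simp: free_alg_simps l_distr)
  also have "\<dots> = (\<Oplus>w \<in> ?W. f w \<otimes> foldr T w \<psi> x) \<oplus> (\<Oplus>w \<in> ?W. g w \<otimes> foldr T w \<psi> x)"
    using c t by (intro finsum_addf) auto
  also have "\<dots> = act f \<psi> x \<oplus> act g \<psi> x"
    using act_superset[OF f W(1) _ W(2) \<psi>] act_superset[OF g W(1) _ W(2) \<psi>] by auto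
  finally show ?thesis .
qed

lemma act_smult:
  assumes a: "a \<in> carrier R" and f: "f \<in> carrier F" and \<psi>: "\<psi> \<in> filt R 0"
  shows "act (a \<odot>\<^bsub>F\<^esub> f) \<psi> x = a \<otimes> act f \<psi> x"
proof -
  let ?W = "{w. f w \<noteq> \<zero>}"
  have W: "finite ?W" "?W \<subseteq> lists X"
    using f by (auto simp: free_alg_simps)
  have c: "f w \<in> carrier R" for w
    using f by (auto simp: free_alg_simps)
  have t: "foldr T w \<psi> x \<in> carrier R" if "w \<in> ?W" for w
    using that W \<psi> by (intro foldr_carrier) auto
  have "{w. (a \<odot>\<^bsub>F\<^esub> f) w \<noteq> \<zero>} \<subseteq> ?W"
    using a by (auto simp: free_alg_simps)
  then have "act (a \<odot>\<^bsub>F\<^esub> f) \<psi> x = (\<Oplus>w \<in> ?W. (a \<odot>\<^bsub>F\<^esub> f) w \<otimes> foldr T w \<psi> x)"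
    using W free_alg_smult_closed[OF a f] \<psi> by (intro act_superset) auto
  also have "\<dots> = (\<Oplus>w \<in> ?W. a \<otimes> (f w \<otimes> foldr T w \<psi> x))"
    using a c t by (intro finsum_cong') (auto simp: free_alg_simps m_assoc)
  also have "\<dots> = a \<otimes> (\<Oplus>w \<in> ?W. f w \<otimes> foldr T w \<psi> x)"
    using a c t W by (intro finsum_rdistr[symmetric]) auto
  finally show ?thesis
    by (simp add: word_sum_def)
qed

lemma act_zero: "act \<zero>\<^bsub>F\<^esub> \<psi> x = \<zero>"
  by (simp add: word_sum_def free_alg_simps)

lemma act_gen:
  assumes x: "x \<in> X" and \<psi>: "\<psi> \<in> filt R 0"
  shows "act (free_gen R x) \<psi> = T x \<psi>"
proof
  fix y
  have t: "T x \<psi> y \<in> carrier R"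
    using filt_carrier[OF filt_op_closed[OF filt_op_gen[OF x] \<psi>]] .
  have "act (free_gen R x) \<psi> y = (\<Oplus>w \<in> {[x]}. free_gen R x w \<otimes> foldr T w \<psi> y)"
    using x \<psi> by (intro act_superset free_gen_carrier) (auto simp: free_gen_def)
  then show "act (free_gen R x) \<psi> y = T x \<psi> y"
    using t by (simp add: free_gen_def)
qed

text \<open>A word may factor as uv in several ways, so the coefficient of the product at w collects
  all of them. Writing the condition w = uv as an indicator and moving the sum over w innermost
  leaves a double sum over u and v; linearity of the operator of u then pulls the sum over v inside
  it.\<close>

lemma act_mult:
  assumes f: "f \<in> carrier F" and g: "g \<in> carrier F" and \<psi>: "\<psi> \<in> filt R 0"
  shows "act (f \<otimes>\<^bsub>F\<^esub> g) \<psi> = act f (act g \<psi>)"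
proof
  fix x
  let ?U = "{w. f w \<noteq> \<zero>}" and ?V = "{w. g w \<noteq> \<zero>}"
  let ?W = "(\<lambda>(u, v). u @ v) ` (?U \<times> ?V)"
  have fin: "finite ?U" "finite ?V" "finite ?W" and sub: "?U \<subseteq> lists X" "?V \<subseteq> lists X"
    using f g by (auto simp: free_alg_simps)
  then have sub_W: "?W \<subseteq> lists X" by fastforce
  have c: "f w \<in> carrier R" "g w \<in> carrier R" for w
    using f g by (auto simp: free_alg_simps)
  have t: "foldr T w \<psi> x \<in> carrier R" if "w \<in> lists X" for w
    using that \<psi> by (intro foldr_carrier) auto
  have tuv: "foldr T (u @ v) \<psi> x \<in> carrier R" if "f u \<noteq> \<zero>" "g v \<noteq> \<zero>" for u v
    using that sub by (intro t) auto
  have conv: "(f \<otimes>\<^bsub>F\<^esub> g) w = (\<Oplus>u \<in> ?U. \<Oplus>v \<in> ?V. if u @ v = w then f u \<otimes> g v else \<zero>)" for w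
    using c fin by (intro free_alg_mult_conv) auto
  \<comment> \<open>The indicator frees the index sets of u, v and w from one another, so that the
    three sums can be interchanged.\<close>
  let ?s = "\<lambda>u v w. if w = u @ v then f u \<otimes> g v \<otimes> foldr T w \<psi> x else \<zero>"
  have s: "?s u v w \<in> carrier R" if "w \<in> ?W" for u v w
    using c t[OF subsetD[OF sub_W that]] by auto
  have "{w. (f \<otimes>\<^bsub>F\<^esub> g) w \<noteq> \<zero>} \<subseteq> ?W"
  proof (rule subsetI, rule ccontr)
    fix w assume "w \<in> {w. (f \<otimes>\<^bsub>F\<^esub> g) w \<noteq> \<zero>}" and w: "w \<notin> ?W"
    moreover have "(\<Oplus>u \<in> ?U. \<Oplus>v \<in> ?V. if u @ v = w then f u \<otimes> g v else \<zero>) = \<zero>"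
      using w by (intro add.finprod_one_eqI) auto
    ultimately show False using conv by simp
  qed
  then have "act (f \<otimes>\<^bsub>F\<^esub> g) \<psi> x = (\<Oplus>w \<in> ?W. (f \<otimes>\<^bsub>F\<^esub> g) w \<otimes> foldr T w \<psi> x)"
    by (intro act_superset free_alg_mult_closed f g fin sub_W \<psi>)
  also have "\<dots> = (\<Oplus>w \<in> ?W. \<Oplus>u \<in> ?U. \<Oplus>v \<in> ?V. ?s u v w)"
  proof (rule finsum_cong')
    fix w assume w: "w \<in> ?W"
    then have tw: "foldr T w \<psi> x \<in> carrier R" using t sub_W by blast
    have "(f \<otimes>\<^bsub>F\<^esub> g) w \<otimes> foldr T w \<psi> x =
        (\<Oplus>u \<in> ?U. (\<Oplus>v \<in> ?V. if u @ v = w then f u \<otimes> g v else \<zero>) \<otimes> foldr T w \<psi> x)"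
      unfolding conv using fin tw c by (intro finsum_ldistr) auto
    also have "\<dots> = (\<Oplus>u \<in> ?U. \<Oplus>v \<in> ?V. (if u @ v = w then f u \<otimes> g v else \<zero>) \<otimes> foldr T w \<psi> x)"
      using fin tw c by (intro finsum_cong' finsum_ldistr) auto
    also have "\<dots> = (\<Oplus>u \<in> ?U. \<Oplus>v \<in> ?V. ?s u v w)"
      using tw c by (intro finsum_cong' funcsetI finsum_closed refl) auto
    finally show "(f \<otimes>\<^bsub>F\<^esub> g) w \<otimes> foldr T w \<psi> x = (\<Oplus>u \<in> ?U. \<Oplus>v \<in> ?V. ?s u v w)" .
  next
    show "(\<lambda>w. \<Oplus>u \<in> ?U. \<Oplus>v \<in> ?V. ?s u v w) \<in> ?W \<rightarrow> carrier R"
      by (intro funcsetI finsum_closed s)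
  qed simp
  also have "\<dots> = (\<Oplus>u \<in> ?U. \<Oplus>w \<in> ?W. \<Oplus>v \<in> ?V. ?s u v w)"
    by (intro finsum_finsum_swap fin finsum_closed funcsetI s)
  also have "\<dots> = (\<Oplus>u \<in> ?U. \<Oplus>v \<in> ?V. \<Oplus>w \<in> ?W. ?s u v w)"
    by (intro finsum_cong' finsum_finsum_swap fin funcsetI finsum_closed s refl)
  also have "\<dots> = (\<Oplus>u \<in> ?U. \<Oplus>v \<in> ?V. f u \<otimes> g v \<otimes> foldr T (u @ v) \<psi> x)"
  proof (intro finsum_cong')
    fix u v assume "u \<in> ?U" "v \<in> ?V"
    then show "(\<Oplus>w \<in> ?W. ?s u v w) = f u \<otimes> g v \<otimes> foldr T (u @ v) \<psi> x"
      by (intro add.finprod_singleton_swap fin funcsetI m_closed c t subsetD[OF sub_W]) auto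
  qed (auto intro!: finsum_closed funcsetI m_closed c tuv simp del: foldr_append)
  also have "\<dots> = (\<Oplus>u \<in> ?U. f u \<otimes> foldr T u (act g \<psi>) x)"
  proof (rule finsum_cong')
    fix u assume u: "u \<in> ?U"
    then have u_op: "filt_op R (foldr T u)"
      using sub filt_op_word by blast
    have v: "foldr T v \<psi> \<in> filt R 0" if "v \<in> ?V" for v
      using that sub \<psi> filt_op_closed[OF filt_op_word] by blast
    have "foldr T u (act g \<psi>) = foldr T u (\<lambda>x. \<Oplus>v \<in> ?V. g v \<otimes> foldr T v \<psi> x)"
      by (simp add: word_sum_def[abs_def])
    also have "\<dots> = (\<lambda>x. \<Oplus>v \<in> ?V. foldr T u (\<lambda>x. g v \<otimes> foldr T v \<psi> x) x)"
      using fin c v by (intro filt_op_finsum[OF u_op] smult_filt) auto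
    finally have "foldr T u (act g \<psi>) x = (\<Oplus>v \<in> ?V. foldr T u (\<lambda>x. g v \<otimes> foldr T v \<psi> x) x)"
      by simp
    also have "\<dots> = (\<Oplus>v \<in> ?V. g v \<otimes> foldr T (u @ v) \<psi> x)"
    proof (rule finsum_cong')
      fix v' assume "v' \<in> ?V"
      then show "foldr T u (\<lambda>x. g v' \<otimes> foldr T v' \<psi> x) x = g v' \<otimes> foldr T (u @ v') \<psi> x"
        using filt_op_smult[OF u_op, of "g v'" "foldr T v' \<psi>"] c v by simp
    qed (use u in \<open>auto intro!: m_closed c tuv simp del: foldr_append\<close>)
    finally have "f u \<otimes> foldr T u (act g \<psi>) x = f u \<otimes> (\<Oplus>v \<in> ?V. g v \<otimes> foldr T (u @ v) \<psi> x)"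
      by simp
    also have "\<dots> = (\<Oplus>v \<in> ?V. f u \<otimes> (g v \<otimes> foldr T (u @ v) \<psi> x))"
      using u by (intro finsum_rdistr) (auto intro!: fin c m_closed tuv simp del: foldr_append)
    also have "\<dots> = (\<Oplus>v \<in> ?V. f u \<otimes> g v \<otimes> foldr T (u @ v) \<psi> x)"
      using u by (intro finsum_cong') (auto intro!: c m_closed tuv simp del: foldr_append simp: c tuv m_assoc)
    finally show "(\<Oplus>v \<in> ?V. f u \<otimes> g v \<otimes> foldr T (u @ v) \<psi> x) = f u \<otimes> foldr T u (act g \<psi>) x" ..
  next
    show "(\<lambda>u. f u \<otimes> foldr T u (act g \<psi>) x) \<in> ?U \<rightarrow> carrier R"
      by (intro funcsetI m_closed c foldr_carrier[OF subsetD[OF sub(1)] act_filt[OF g \<psi>]])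
  qed simp
  finally show "act (f \<otimes>\<^bsub>F\<^esub> g) \<psi> x = act f (act g \<psi>) x"
    by (simp add: word_sum_def)
qed

lemma act_finsum:
  assumes "finite A" "\<And>k. k \<in> A \<Longrightarrow> g k \<in> carrier F" and \<psi>: "\<psi> \<in> filt R 0"
  shows "act (\<Oplus>\<^bsub>F\<^esub>k \<in> A. g k) \<psi> x = (\<Oplus>k \<in> A. act (g k) \<psi> x)"
  using assms(1,2)
proof (induction A)
  case empty
  interpret FA: abelian_group F by (rule free_alg_abelian_group)
  show ?case by (simp add: act_zero)
next
  case (insert k A)
  interpret FA: abelian_group F by (rule free_alg_abelian_group)
  have "act (g j) \<psi> x \<in> carrier R" if "j \<in> insert k A" for j
    using that insert.prems by (intro filt_carrier[OF act_filt[OF _ \<psi>]]) auto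
  then show ?case
    using insert act_add[OF _ _ \<psi>] by (simp add: Pi_def)
qed

section \<open>Ideals of the elements that raise the filtration\<close>

definition filt_ideal :: "nat \<Rightarrow> ('x list \<Rightarrow> 'a) set" where
  "filt_ideal n = {f \<in> carrier F. \<forall>\<psi> \<in> filt R 0. act f \<psi> \<in> filt R n}"

lemma filt_ideal_decreasing: "filt_ideal (Suc n) \<subseteq> filt_ideal n"
  using filt_mono[of n "Suc n" R] by (auto simp: filt_ideal_def)

text \<open>\<open>filt_ideal n\<close> is the annihilator of the quotient of
  \<open>filt R 0\<close> by \<open>filt R n\<close>. It is two-sided because every element of the
  free algebra preserves both of these spaces.\<close>

lemma alg_ideal_filt_ideal:
  assumes "field R"
  shows "alg_ideal R F (filt_ideal n)"
proof -
  have "submodule R (filt_ideal n) F"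
  proof (rule submodule.intro[OF free_alg_module])
    show "filt_ideal n \<subseteq> carrier F"
      by (auto simp: filt_ideal_def)
    show "f \<oplus>\<^bsub>F\<^esub> g \<in> filt_ideal n" if "f \<in> filt_ideal n" "g \<in> filt_ideal n" for f g
    proof -
      have fg: "f \<in> carrier F" "g \<in> carrier F"
        using that by (auto simp: filt_ideal_def)
      have "act (f \<oplus>\<^bsub>F\<^esub> g) \<psi> \<in> filt R n" if \<psi>: "\<psi> \<in> filt R 0" for \<psi>
      proof -
        have "act (f \<oplus>\<^bsub>F\<^esub> g) \<psi> = (\<lambda>x. act f \<psi> x \<oplus> act g \<psi> x)"
          using act_add[OF fg \<psi>] by blast
        moreover have "act f \<psi> \<in> filt R n" "act g \<psi> \<in> filt R n"
          using \<psi> \<open>f \<in> filt_ideal n\<close> \<open>g \<in> filt_ideal n\<close> by (simp_all add: filt_ideal_def)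
        ultimately show ?thesis
          by (simp add: add_filt)
      qed
      then show ?thesis
        using free_alg_add_closed[OF fg] by (simp add: filt_ideal_def)
    qed
    show "\<zero>\<^bsub>F\<^esub> \<in> filt_ideal n"
    proof -
      have "act \<zero>\<^bsub>F\<^esub> \<psi> = (\<lambda>x. \<zero>)" for \<psi>
        by (rule ext) (rule act_zero)
      then show ?thesis
        by (simp add: filt_ideal_def zero_filt) (simp add: free_alg_simps)
    qed
    show "c \<odot>\<^bsub>F\<^esub> f \<in> filt_ideal n" if "c \<in> carrier R" "f \<in> filt_ideal n" for c f
    proof -
      have f: "f \<in> carrier F"
        using that by (auto simp: filt_ideal_def)
      have "act (c \<odot>\<^bsub>F\<^esub> f) \<psi> \<in> filt R n" if \<psi>: "\<psi> \<in> filt R 0" for \<psi>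
      proof -
        have "act (c \<odot>\<^bsub>F\<^esub> f) \<psi> = (\<lambda>x. c \<otimes> act f \<psi> x)"
          using act_smult[OF \<open>c \<in> carrier R\<close> f \<psi>] by blast
        moreover have "act f \<psi> \<in> filt R n"
          using \<psi> \<open>f \<in> filt_ideal n\<close> by (simp add: filt_ideal_def)
        ultimately show ?thesis
          using \<open>c \<in> carrier R\<close> by (simp add: smult_filt)
      qed
      then show ?thesis
        using free_alg_smult_closed[OF \<open>c \<in> carrier R\<close> f] by (simp add: filt_ideal_def)
    qed
  qed
  then have "subspace R (filt_ideal n) F"
    using assms free_alg_module by (simp add: subspace_def vectorspace_def)
  moreover have "a \<otimes>\<^bsub>F\<^esub> f \<in> filt_ideal n \<and> f \<otimes>\<^bsub>F\<^esub> a \<in> filt_ideal n"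
    if a: "a \<in> carrier F" and "f \<in> filt_ideal n" for a f
  proof -
    have f: "f \<in> carrier F" and act_f: "\<And>\<psi>. \<psi> \<in> filt R 0 \<Longrightarrow> act f \<psi> \<in> filt R n"
      using \<open>f \<in> filt_ideal n\<close> by (auto simp: filt_ideal_def)
    show ?thesis
      using a f act_filt[OF a] act_f
      by (simp add: filt_ideal_def free_alg_mult_closed act_mult)
  qed
  ultimately show ?thesis
    by (simp add: alg_ideal_def left_alg_ideal_def right_alg_ideal_def)
qed

lemma diff_in_filt_ideal:
  assumes l: "l \<in> carrier F" and r: "r \<in> carrier F"
    and eq: "\<And>\<psi>. \<psi> \<in> filt R 0 \<Longrightarrow> act l \<psi> = act r \<psi>"
  shows "l \<ominus>\<^bsub>F\<^esub> r \<in> filt_ideal n"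
proof -
  interpret FA: abelian_group F by (rule free_alg_abelian_group)
  have "act (l \<ominus>\<^bsub>F\<^esub> r) \<psi> = (\<lambda>x. \<zero>)" if \<psi>: "\<psi> \<in> filt R 0" for \<psi>
  proof
    fix x
    \<comment> \<open>Replacing l by r before recombining leaves r + (-r), so the action of a
      negative never has to be computed.\<close>
    have "act (l \<ominus>\<^bsub>F\<^esub> r) \<psi> x = act r \<psi> x \<oplus> act (\<ominus>\<^bsub>F\<^esub> r) \<psi> x"
      using l r \<psi> eq by (simp add: FA.minus_eq act_add)
    also have "\<dots> = act (r \<oplus>\<^bsub>F\<^esub> (\<ominus>\<^bsub>F\<^esub> r)) \<psi> x"
      using r \<psi> by (intro act_add[symmetric]) auto
    also have "\<dots> = \<zero>"
      using r by (simp add: FA.r_neg act_zero)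
    finally show "act (l \<ominus>\<^bsub>F\<^esub> r) \<psi> x = \<zero>" .
  qed
  then show ?thesis
    using l r by (simp add: filt_ideal_def zero_filt)
qed

end

section \<open>Ideals and quotients of non-unital algebras\<close>

text \<open>Each x n lies outside J (n+1), which contains the span of all later x. The induction
  therefore adds vectors at the front, and its starting index has to stay general.\<close>

lemma (in vectorspace) strict_chain_not_fin_dim:
  assumes J: "\<And>n. subspace K (J n) V" and decr: "\<And>n. J (Suc n) \<subseteq> J n"
    and x: "\<And>n. x n \<in> J n - J (Suc n)"
  shows "\<not> fin_dim"
proof
  assume "fin_dim"
  then obtain B where B: "finite B" "B \<subseteq> carrier V" "gen_set B"
    by (auto simp: fin_dim_def)
  have J_V: "J n \<subseteq> carrier V" for n
    using J[of n] by (simp add: subspace_def submodule_def)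
  have "finite (x ` {n..<n + k}) \<and> card (x ` {n..<n + k}) = k \<and> x ` {n..<n + k} \<subseteq> J n \<and>
      lin_indpt (x ` {n..<n + k})" for n k
  proof (induction k arbitrary: n)
    case 0
    then show ?case by (simp add: lin_dep_def)
  next
    case (Suc k)
    let ?S = "x ` {Suc n..<Suc n + k}"
    have S: "finite ?S" "card ?S = k" "?S \<subseteq> J (Suc n)" "lin_indpt ?S"
      using Suc[of "Suc n"] by auto
    have "span ?S \<subseteq> J (Suc n)"
      using S(3) J[of "Suc n"] by (intro span_is_subset) (simp_all add: subspace_def)
    then have notin: "x n \<notin> span ?S"
      using x[of n] by blast
    have SV: "?S \<subseteq> carrier V" and xV: "x n \<in> carrier V"
      using S(3) J_V x[of n] by blast+
    then have nS: "x n \<notin> ?S"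
      using notin in_own_span by blast
    have "lin_indpt (insert (x n) ?S)"
      using lin_dep_iff_in_span[OF SV S(4) xV nS] notin by simp
    moreover have "{n..<n + Suc k} = insert n {Suc n..<Suc n + k}"
      by auto
    then have "x ` {n..<n + Suc k} = insert (x n) ?S"
      by (metis image_insert)
    moreover have "insert (x n) ?S \<subseteq> J n"
      using x[of n] S(3) decr[of n] by blast
    ultimately show ?case
      using S nS by simp
  qed
  \<comment> \<open>One independent vector more than a finite generating set has elements.\<close>
  from this[of 0 "Suc (card B)"] show False
    using li_smaller_than_gen[OF _ B(1) _ B(2) _ B(3)] J_V
    by (metis Suc_n_not_le_n subset_trans)
qed

lemma alg_ideal_iff:
  "alg_ideal K A J \<longleftrightarrow> vectorspace K A \<and> J \<subseteq> carrier A \<and> \<zero>\<^bsub>A\<^esub> \<in> J \<and>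
     (\<forall>x \<in> J. \<forall>y \<in> J. x \<oplus>\<^bsub>A\<^esub> y \<in> J) \<and> (\<forall>c \<in> carrier K. \<forall>x \<in> J. c \<odot>\<^bsub>A\<^esub> x \<in> J) \<and>
     (\<forall>a \<in> carrier A. \<forall>x \<in> J. a \<otimes>\<^bsub>A\<^esub> x \<in> J \<and> x \<otimes>\<^bsub>A\<^esub> a \<in> J)" (is "?L \<longleftrightarrow> ?R")
proof
  show "?L \<Longrightarrow> ?R"
    by (auto simp: alg_ideal_def left_alg_ideal_def right_alg_ideal_def subspace_def
        dest: submodule.subset submodule.m_closed submodule.zero_closed submodule.smult_closed)
  show "?R \<Longrightarrow> ?L"
    by (auto simp: alg_ideal_def left_alg_ideal_def right_alg_ideal_def subspace_def vectorspace_def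
        intro!: submodule.intro)
qed

text \<open>These product laws make the multiplication of cosets of an ideal independent of
  representatives; the vector space supplies the rest.\<close>

locale nonunital_alg = vectorspace K A for K and A (structure) +
  assumes m_closed: "x \<in> carrier A \<Longrightarrow> y \<in> carrier A \<Longrightarrow> x \<otimes> y \<in> carrier A"
    and l_distr: "x \<in> carrier A \<Longrightarrow> y \<in> carrier A \<Longrightarrow> z \<in> carrier A \<Longrightarrow> (x \<oplus> y) \<otimes> z = x \<otimes> z \<oplus> y \<otimes> z"
    and r_distr: "x \<in> carrier A \<Longrightarrow> y \<in> carrier A \<Longrightarrow> z \<in> carrier A \<Longrightarrow> z \<otimes> (x \<oplus> y) = z \<otimes> x \<oplus> z \<otimes> y"
begin

text \<open>The intersection over an empty family would be the whole type; the ideal J keeps it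
  inside the carrier.\<close>

lemma alg_ideal_gen_alg_ideal:
  assumes "alg_ideal K A J" "S \<subseteq> J"
  shows "alg_ideal K A (gen_alg_ideal K A S)"
proof -
  have J: "J \<in> {J. alg_ideal K A J \<and> S \<subseteq> J}"
    using assms by blast
  then have "\<Inter>{J. alg_ideal K A J \<and> S \<subseteq> J} \<subseteq> carrier A"
    by (auto simp: alg_ideal_iff)
  then show ?thesis
    unfolding gen_alg_ideal_def
    by (subst alg_ideal_iff) (simp add: vectorspace_axioms alg_ideal_iff[of K A])
qed

end

section \<open>The quotient by an ideal\<close>

locale alg_quotient = nonunital_alg +
  fixes I
  assumes I: "alg_ideal K A I"
begin

abbreviation Q where "Q \<equiv> quotient_alg A I"

lemma I_closed:
  "x \<in> I \<Longrightarrow> x \<in> carrier A" "x \<in> I \<Longrightarrow> y \<in> I \<Longrightarrow> x \<oplus> y \<in> I" "\<zero> \<in> I"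
  "a \<in> carrier K \<Longrightarrow> x \<in> I \<Longrightarrow> a \<odot>\<^bsub>A\<^esub> x \<in> I"
  "x \<in> I \<Longrightarrow> y \<in> carrier A \<Longrightarrow> x \<otimes> y \<in> I" "x \<in> I \<Longrightarrow> y \<in> carrier A \<Longrightarrow> y \<otimes> x \<in> I"
  using I by (auto simp: alg_ideal_iff)

sublocale I: abelian_subgroup I A
proof (intro abelian_subgroupI3 additive_subgroup.intro)
  have "\<ominus> x \<in> I" if "x \<in> I" for x
  proof -
    \<comment> \<open>Negatives come from the scalar -1, as an ideal is a subspace.\<close>
    have "\<ominus> x = (\<ominus>\<^bsub>K\<^esub> \<one>\<^bsub>K\<^esub>) \<odot>\<^bsub>A\<^esub> x"
      using that I_closed(1) smult_minus_1 by simp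
    then show ?thesis using that I_closed(4) by simp
  qed
  then show "subgroup I (add_monoid A)"
    by (intro add.subgroupI) (use I_closed in \<open>auto simp: a_inv_def\<close>)
qed (rule M.abelian_group_axioms)

lemma coset_eq_iff:
  assumes "x \<in> carrier A" "y \<in> carrier A"
  shows "I +> x = I +> y \<longleftrightarrow> x \<ominus> y \<in> I"
  using I.a_rcos_module[OF assms(2,1)] I.a_repr_independence'[OF _ assms(2), of x]
    I.a_rcos_self[OF assms(1)] by (auto simp: M.minus_eq)

lemma coset_cases:
  assumes "X \<in> carrier Q"
  obtains x where "x \<in> carrier A" "X = I +> x"
  using assms by (auto simp: quotient_alg_def A_RCOSETS_defs a_r_coset_def)

lemma coset_memD: "x \<in> carrier A \<Longrightarrow> y \<in> I +> x \<Longrightarrow> \<exists>i \<in> I. y = i \<oplus> x"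
  by (auto simp: a_r_coset_def r_coset_def)

lemma coset_self: "x \<in> carrier A \<Longrightarrow> x \<in> I +> x"
  by (rule I.a_rcos_self)

lemma coset_absorb: "x \<in> carrier A \<Longrightarrow> i \<in> I \<Longrightarrow> I +> (i \<oplus> x) = I +> x"
  using I_closed(1) by (simp add: coset_eq_iff M.minus_eq M.a_assoc M.r_neg)

lemma Q_zero: "\<zero>\<^bsub>Q\<^esub> = I +> \<zero>"
  using I.a_rcos_const[OF I_closed(3)] by (simp add: quotient_alg_def)

lemma coset_carrier: "x \<in> carrier A \<Longrightarrow> I +> x \<in> carrier Q"
  by (auto simp: quotient_alg_def A_RCOSETS_defs a_r_coset_def)

lemma Q_add: "x \<in> carrier A \<Longrightarrow> y \<in> carrier A \<Longrightarrow> (I +> x) \<oplus>\<^bsub>Q\<^esub> (I +> y) = I +> (x \<oplus> y)"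
  by (simp add: quotient_alg_def I.a_rcos_sum)

text \<open>\<open>quotient_alg\<close> takes a union over all representatives. Since I absorbs
  their differences, this is a union of copies of one coset; the same holds for products.\<close>

lemma Q_smult:
  assumes "a \<in> carrier K" "x \<in> carrier A"
  shows "a \<odot>\<^bsub>Q\<^esub> (I +> x) = I +> (a \<odot>\<^bsub>A\<^esub> x)"
proof -
  have "I +> (a \<odot>\<^bsub>A\<^esub> y) = I +> (a \<odot>\<^bsub>A\<^esub> x)" if "y \<in> I +> x" for y
    using coset_memD[OF assms(2) that] assms I_closed by (auto simp: smult_r_distr coset_absorb)
  then have "(\<Union>y \<in> I +> x. I +> (a \<odot>\<^bsub>A\<^esub> y)) = I +> (a \<odot>\<^bsub>A\<^esub> x)"
    by (intro UN_constant_eq[OF coset_self[OF assms(2)]] ballI)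
  then show ?thesis
    by (simp add: quotient_alg_def)
qed

lemma Q_mult:
  assumes "x \<in> carrier A" "y \<in> carrier A"
  shows "(I +> x) \<otimes>\<^bsub>Q\<^esub> (I +> y) = I +> (x \<otimes> y)"
proof -
  have "I +> (x' \<otimes> y') = I +> (x \<otimes> y)" if x': "x' \<in> I +> x" and y': "y' \<in> I +> y" for x' y'
  proof -
    obtain i j where ij: "i \<in> I" "j \<in> I" and eq: "x' = i \<oplus> x" "y' = j \<oplus> y"
      using coset_memD assms x' y' by metis
    have carr: "i \<in> carrier A" "j \<in> carrier A" "y' \<in> carrier A"
      using ij I_closed(1) assms by (auto simp: eq)
    \<comment> \<open>Changing both representatives gives x'y' = iy' + xj + xy, where the first two
      terms lie in I, one by each of the two ideal laws.\<close>
    have "x' \<otimes> y' = i \<otimes> y' \<oplus> x \<otimes> y'"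
      using carr assms by (simp only: eq(1) l_distr)
    also have "x \<otimes> y' = x \<otimes> j \<oplus> x \<otimes> y"
      using carr assms by (simp only: eq(2) r_distr)
    finally show ?thesis
      using ij carr I_closed(5,6) assms by (simp add: coset_absorb m_closed)
  qed
  then have "(\<Union>x' \<in> I +> x. \<Union>y' \<in> I +> y. I +> (x' \<otimes> y')) = I +> (x \<otimes> y)"
    by (intro UN_constant_eq[OF coset_self[OF assms(1)]] UN_constant_eq[OF coset_self[OF assms(2)]] ballI)
  then show ?thesis
    by (simp add: quotient_alg_def rcoset_mult_def)
qed

lemma vectorspace_Q: "vectorspace K Q"
proof -
  have ab: "abelian_group Q"
  proof (rule abelian_groupI)
    show "\<exists>Y \<in> carrier Q. Y \<oplus>\<^bsub>Q\<^esub> X = \<zero>\<^bsub>Q\<^esub>" if X: "X \<in> carrier Q" for X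
    proof -
      obtain x where x: "x \<in> carrier A" "X = I +> x"
        using X by (rule coset_cases)
      then have "(I +> (\<ominus> x)) \<oplus>\<^bsub>Q\<^esub> X = \<zero>\<^bsub>Q\<^esub>"
        by (simp add: Q_add Q_zero M.l_neg)
      then show ?thesis
        using x coset_carrier by (intro bexI[of _ "I +> (\<ominus> x)"]) auto
    qed
  qed (auto elim!: coset_cases simp: Q_add Q_zero coset_carrier M.a_ac)
  have "module K Q"
  proof (rule moduleI)
    show "cring K" ..
    show "abelian_group Q" by (rule ab)
    show "a \<odot>\<^bsub>Q\<^esub> X \<in> carrier Q" if "a \<in> carrier K" "X \<in> carrier Q" for a X
      using that by (auto elim!: coset_cases simp: Q_smult coset_carrier)
    show "(a \<oplus>\<^bsub>K\<^esub> b) \<odot>\<^bsub>Q\<^esub> X = a \<odot>\<^bsub>Q\<^esub> X \<oplus>\<^bsub>Q\<^esub> b \<odot>\<^bsub>Q\<^esub> X"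
      if "a \<in> carrier K" "b \<in> carrier K" "X \<in> carrier Q" for a b X
      using that by (auto elim!: coset_cases simp: Q_smult Q_add smult_l_distr)
    show "a \<odot>\<^bsub>Q\<^esub> (X \<oplus>\<^bsub>Q\<^esub> Y) = a \<odot>\<^bsub>Q\<^esub> X \<oplus>\<^bsub>Q\<^esub> a \<odot>\<^bsub>Q\<^esub> Y"
      if "a \<in> carrier K" "X \<in> carrier Q" "Y \<in> carrier Q" for a X Y
      using that by (auto elim!: coset_cases simp: Q_smult Q_add smult_r_distr)
    show "(a \<otimes>\<^bsub>K\<^esub> b) \<odot>\<^bsub>Q\<^esub> X = a \<odot>\<^bsub>Q\<^esub> (b \<odot>\<^bsub>Q\<^esub> X)"
      if "a \<in> carrier K" "b \<in> carrier K" "X \<in> carrier Q" for a b X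
      using that by (auto elim!: coset_cases simp: Q_smult smult_assoc1)
    show "\<one>\<^bsub>K\<^esub> \<odot>\<^bsub>Q\<^esub> X = X" if "X \<in> carrier Q" for X
      using that by (auto elim!: coset_cases simp: Q_smult)
  qed
  then show ?thesis
    using vectorspace_axioms by (simp add: vectorspace_def)
qed

lemma alg_ideal_image:
  assumes J: "alg_ideal K A J"
  shows "alg_ideal K Q ((+>) I ` J)"
proof -
  have JJ: "J \<subseteq> carrier A" "\<And>x y. x \<in> J \<Longrightarrow> y \<in> J \<Longrightarrow> x \<oplus> y \<in> J" "\<zero> \<in> J"
    "\<And>a x. a \<in> carrier K \<Longrightarrow> x \<in> J \<Longrightarrow> a \<odot>\<^bsub>A\<^esub> x \<in> J"
    "\<And>x y. x \<in> J \<Longrightarrow> y \<in> carrier A \<Longrightarrow> x \<otimes> y \<in> J"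
    "\<And>x y. x \<in> J \<Longrightarrow> y \<in> carrier A \<Longrightarrow> y \<otimes> x \<in> J"
    using J by (auto simp: alg_ideal_iff)
  have "\<zero>\<^bsub>Q\<^esub> \<in> (+>) I ` J"
    using JJ(3) by (auto simp: Q_zero intro: rev_image_eqI)
  moreover have "X \<otimes>\<^bsub>Q\<^esub> Y \<in> (+>) I ` J \<and> Y \<otimes>\<^bsub>Q\<^esub> X \<in> (+>) I ` J"
    if X: "X \<in> carrier Q" and Y: "Y \<in> (+>) I ` J" for X Y
  proof -
    obtain x y where "x \<in> carrier A" "X = I +> x" "y \<in> J" "Y = I +> y"
      using X Y by (auto elim: coset_cases)
    then show ?thesis
      using JJ(1,5,6) by (auto simp: Q_mult subset_iff)
  qed
  ultimately show ?thesis
    using vectorspace_Q JJ(1,2,4)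
    by (auto simp: alg_ideal_iff coset_carrier Q_add Q_smult subset_iff)
qed

text \<open>J is a union of cosets of I, so strict inclusions and the elements witnessing them
  survive in the quotient.\<close>

lemma coset_in_image_iff:
  assumes J: "alg_ideal K A J" and "I \<subseteq> J" and x: "x \<in> carrier A"
  shows "I +> x \<in> (+>) I ` J \<longleftrightarrow> x \<in> J"
proof
  assume "I +> x \<in> (+>) I ` J"
  then obtain y where y: "y \<in> J" "I +> x = I +> y" by blast
  then obtain i where "i \<in> I" "x = i \<oplus> y"
    using coset_self[OF x] coset_memD[of y x] J by (auto simp: alg_ideal_iff)
  then show "x \<in> J"
    using y(1) \<open>I \<subseteq> J\<close> J by (auto simp: alg_ideal_iff)
qed blast

end

section \<open>Consequences of a strictly descending chain of ideals\<close>

lemma strict_ideal_chain: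
  assumes V: "vectorspace K L" and J: "\<And>n::nat. alg_ideal K L (J n)"
    and decr: "\<And>n. J (Suc n) \<subseteq> J n" and x: "\<And>n. x n \<in> J n - J (Suc n)"
  shows "\<not> vectorspace.fin_dim K L \<and> \<not> simple_alg K L \<and> infinite {J. alg_ideal K L J} \<and>
    \<not> left_artinian_alg K L \<and> \<not> right_artinian_alg K L"
proof (intro conjI)
  have sub: "subspace K (J n) L" and l: "left_alg_ideal K L (J n)" and r: "right_alg_ideal K L (J n)" for n
    using J[of n] by (auto simp: alg_ideal_def left_alg_ideal_def)
  show "\<not> vectorspace.fin_dim K L"
    using vectorspace.strict_chain_not_fin_dim[of K L J x] V sub decr x by blast
  have ne: "J (Suc n) \<noteq> J n" for n
    using x[of n] by blast
  \<comment> \<open>Complements turn the descending chain into an increasing one, for which strict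
    monotonicity gives injectivity.\<close>
  have "strict_mono (\<lambda>n. - J n)"
    unfolding strict_mono_Suc_iff using decr ne by blast
  then have "inj (\<lambda>n. - J n)"
    by (rule strict_mono_imp_inj_on)
  then have "inj J"
    by (simp add: inj_def)
  then have "infinite (range J)"
    using finite_imageD by blast
  moreover have "range J \<subseteq> {J. alg_ideal K L J}"
    using J by blast
  ultimately show inf: "infinite {J. alg_ideal K L J}"
    using infinite_super by blast
  show "\<not> simple_alg K L"
  proof
    assume "simple_alg K L"
    then have "{J. alg_ideal K L J} \<subseteq> {{\<zero>\<^bsub>L\<^esub>}, carrier L}"
      by (auto simp: simple_alg_def)
    then show False
      using inf finite_subset by blast
  qed
  show "\<not> left_artinian_alg K L" "\<not> right_artinian_alg K L"
    unfolding left_artinian_alg_def right_artinian_alg_def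
    using l r decr ne by (meson le_Suc_eq le_refl)+
qed

section \<open>Transfer of the chain to a presented algebra\<close>

context filtered_action
begin

lemma nonunital_alg_free_alg: "field R \<Longrightarrow> nonunital_alg R F"
  by (intro nonunital_alg.intro nonunital_alg_axioms.intro vectorspace.intro free_alg_module
      free_alg_mult_closed free_alg_l_distr free_alg_r_distr)

text \<open>The presentation enters only through \<open>rel\<close>: differences of related elements
  act as zero, so the ideal they generate lies in every \<open>filt_ideal n\<close>. The element p
  descends at least one step in the filtration, and \<open>p_sharp\<close> provides a vector on
  which its powers descend no further than that.\<close>

lemma presented_alg_infinite_descent:
  assumes field: "field R"
    and rel: "\<And>l r. (l, r) \<in> E \<Longrightarrow> l \<in> carrier F \<and> r \<in> carrier F \<and> (\<forall>\<psi> \<in> filt R 0. act l \<psi> = act r \<psi>)"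
    and p: "p \<in> carrier F"
    and p_raises: "\<And>n \<psi>. \<psi> \<in> filt R n \<Longrightarrow> act p \<psi> \<in> filt R (Suc n)"
    and \<psi>: "\<psi> \<in> filt R 0" and p_sharp: "\<And>n. (act p ^^ n) \<psi> \<notin> filt R (Suc n)"
  defines "L \<equiv> presented_alg R X E"
  shows "\<not> vectorspace.fin_dim R L \<and> \<not> simple_alg R L \<and> infinite {J. alg_ideal R L J} \<and>
    \<not> left_artinian_alg R L \<and> \<not> right_artinian_alg R L \<and> \<not> von_neumann_regular L"
proof -
  let ?S = "{l \<ominus>\<^bsub>F\<^esub> r | l r. (l, r) \<in> E}"
  let ?I = "gen_alg_ideal R F ?S"
  interpret FA: nonunital_alg R F
    using field by (rule nonunital_alg_free_alg)
  have S: "?S \<subseteq> filt_ideal n" for n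
    using rel diff_in_filt_ideal by blast
  have J: "alg_ideal R F (filt_ideal n)" for n
    using field by (rule alg_ideal_filt_ideal)
  have I_J: "?I \<subseteq> filt_ideal n" for n
    unfolding gen_alg_ideal_def using S[of n] J[of n] by blast
  interpret Q: alg_quotient R F ?I
    by (intro alg_quotient.intro alg_quotient_axioms.intro FA.nonunital_alg_axioms
        FA.alg_ideal_gen_alg_ideal[OF J S])
  have L: "L = quotient_alg F ?I"
    by (simp add: L_def presented_alg_def)
  \<comment> \<open>Index 0 is skipped: \<open>filt_ideal 0\<close> is the whole free algebra, which
    contains no zeroth power of p to separate it from \<open>filt_ideal 1\<close>.\<close>
  let ?J = "\<lambda>n. (\<lambda>f. ?I +>\<^bsub>F\<^esub> f) ` filt_ideal (Suc n)"
  \<comment> \<open>\<open>pw n\<close> is the power with exponent n + 1, bracketed to the right so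
    that \<open>act_mult\<close> peels off one factor at a time.\<close>
  define pw where "pw = rec_nat p (\<lambda>_ q. p \<otimes>\<^bsub>F\<^esub> q)"
  have pw_0: "pw 0 = p" and pw_Suc: "pw (Suc n) = p \<otimes>\<^bsub>F\<^esub> pw n" for n
    by (simp_all add: pw_def)
  have pw: "pw n \<in> carrier F" for n
    by (induction n) (simp_all add: pw_0 pw_Suc p FA.m_closed)
  have act_pw: "act (pw n) \<phi> = (act p ^^ Suc n) \<phi>" if "\<phi> \<in> filt R 0" for n \<phi>
    using that by (induction n) (simp_all add: pw_0 pw_Suc act_mult p pw)
  have raises: "(act p ^^ n) \<phi> \<in> filt R n" if "\<phi> \<in> filt R 0" for n \<phi>
    using that p_raises by (induction n) simp_all
  have pw_in: "pw n \<in> filt_ideal (Suc n)" for n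
    unfolding filt_ideal_def using pw act_pw raises[of _ "Suc n"] by simp
  have pw_notin: "pw n \<notin> filt_ideal (Suc (Suc n))" for n
  proof
    assume "pw n \<in> filt_ideal (Suc (Suc n))"
    then have "act (pw n) \<psi> \<in> filt R (Suc (Suc n))"
      using \<psi> by (simp add: filt_ideal_def)
    then show False
      using act_pw[OF \<psi>, of n] p_sharp[of "Suc n"] by simp
  qed
  have "\<not> von_neumann_regular L"
  proof
    assume "von_neumann_regular L"
    then obtain Y where Y: "Y \<in> carrier L" "(?I +>\<^bsub>F\<^esub> p) \<otimes>\<^bsub>L\<^esub> Y \<otimes>\<^bsub>L\<^esub> (?I +>\<^bsub>F\<^esub> p) = ?I +>\<^bsub>F\<^esub> p"
      using Q.coset_carrier[OF p] unfolding von_neumann_regular_def L by blast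
    obtain y where y: "y \<in> carrier F" "Y = ?I +>\<^bsub>F\<^esub> y"
      using Y(1) unfolding L by (rule Q.coset_cases)
    let ?q = "p \<otimes>\<^bsub>F\<^esub> y \<otimes>\<^bsub>F\<^esub> p"
    have eq: "?I +>\<^bsub>F\<^esub> p = ?I +>\<^bsub>F\<^esub> ?q"
      using Y(2) y p by (simp add: L Q.Q_mult FA.m_closed)
    have "act ?q \<phi> \<in> filt R (Suc (Suc 0))" if "\<phi> \<in> filt R 0" for \<phi>
      using that y p act_filt[OF p that] act_filt[OF y(1) p_raises[OF that]]
      by (simp add: act_mult FA.m_closed act_filt p_raises)
    then have "?q \<in> filt_ideal (Suc (Suc 0))"
      using p y by (simp add: filt_ideal_def FA.m_closed)
    \<comment> \<open>p and \<open>?q\<close> share a coset, and \<open>filt_ideal 2\<close>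
      contains the ideal factored out, so membership passes from \<open>?q\<close> to p.\<close>
    then have "p \<in> filt_ideal (Suc (Suc 0))"
      using Q.coset_in_image_iff[OF J I_J p, of "Suc (Suc 0)"] eq by blast
    then show False
      using pw_notin[of 0] by (simp add: pw_0)
  qed
  moreover have "?I +>\<^bsub>F\<^esub> pw n \<in> ?J n - ?J (Suc n)" for n
    using Q.coset_in_image_iff[OF J I_J pw] pw_in pw_notin by blast
  moreover have "?J (Suc n) \<subseteq> ?J n" for n
    using filt_ideal_decreasing by blast
  ultimately show ?thesis
    using strict_ideal_chain[of R L ?J "\<lambda>n. ?I +>\<^bsub>F\<^esub> pw n"] Q.vectorspace_Q Q.alg_ideal_image[OF J]
    unfolding L by blast
qed

end

section \<open>Isomorphisms between finite sums of sequence spaces\<close>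

text \<open>The index \<open>(i, a)\<close> is coordinate \<open>a\<close> of the \<open>i\<close>-th summand.\<close>

definition block_iso ::
    "('k, 'm) ring_scheme \<Rightarrow> nat \<Rightarrow> nat \<Rightarrow>
     (((nat \<times> nat) \<times> nat \<Rightarrow> 'k) \<Rightarrow> ((nat \<times> nat) \<times> nat \<Rightarrow> 'k)) \<Rightarrow>
     (((nat \<times> nat) \<times> nat \<Rightarrow> 'k) \<Rightarrow> ((nat \<times> nat) \<times> nat \<Rightarrow> 'k)) \<Rightarrow> bool" where
  "block_iso K m n A B \<longleftrightarrow> filt_op K A \<and> filt_op K B \<and>
     (\<forall>\<psi> i a e. m \<le> i \<longrightarrow> A \<psi> ((i, a), e) = \<zero>\<^bsub>K\<^esub>) \<and>
     (\<forall>\<psi> j b e. n \<le> j \<longrightarrow> B \<psi> ((j, b), e) = \<zero>\<^bsub>K\<^esub>) \<and>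
     (\<forall>\<psi> \<in> filt K 0. (\<forall>i a e. m \<le> i \<longrightarrow> \<psi> ((i, a), e) = \<zero>\<^bsub>K\<^esub>) \<longrightarrow> A (B \<psi>) = \<psi>) \<and>
     (\<forall>\<psi> \<in> filt K 0. (\<forall>j b e. n \<le> j \<longrightarrow> \<psi> ((j, b), e) = \<zero>\<^bsub>K\<^esub>) \<longrightarrow> B (A \<psi>) = \<psi>)"

lemma block_iso_sym: "block_iso K m n A B \<Longrightarrow> block_iso K n m B A"
  unfolding block_iso_def by blast

text \<open>A pullback: \<sigma> goes from the coordinates of the target to those of the source,
  against the direction of the operator.\<close>

definition reindex ::
    "('k, 'm) ring_scheme \<Rightarrow> nat \<Rightarrow> (nat \<times> nat \<Rightarrow> nat \<times> nat) \<Rightarrow>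
     ((nat \<times> nat) \<times> nat \<Rightarrow> 'k) \<Rightarrow> (nat \<times> nat) \<times> nat \<Rightarrow> 'k" where
  "reindex K m \<sigma> \<psi> = (\<lambda>(x, e). if fst x < m then \<psi> (\<sigma> x, e) else \<zero>\<^bsub>K\<^esub>)"

text \<open>Multiplication by t, on sequences of coefficients.\<close>

fun shift :: "('k, 'm) ring_scheme \<Rightarrow> (nat \<Rightarrow> 'k) \<Rightarrow> nat \<Rightarrow> 'k" where
  "shift K f 0 = \<zero>\<^bsub>K\<^esub>"
| "shift K f (Suc e) = f e"

text \<open>On the coordinates \<open>(0, 0)\<close> and \<open>(1, 0)\<close>, \<open>twist\<close> is the matrix with rows $(1, 1)$ and
  $(t - 1, t)$, whose inverse has rows $(t, -1)$ and $(1 - t, 1)$.  Both diagonal entries at \<open>(1, 0)\<close>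
  matter: their product is \<open>t\<close>.\<close>

definition twist ::
    "('k, 'm) ring_scheme \<Rightarrow> ((nat \<times> nat) \<times> nat \<Rightarrow> 'k) \<Rightarrow> (nat \<times> nat) \<times> nat \<Rightarrow> 'k" where
  "twist K \<psi> = (\<lambda>(x, e).
     if x = (0, 0) then \<psi> ((0, 0), e) \<oplus>\<^bsub>K\<^esub> \<psi> ((1, 0), e)
     else if x = (1, 0) then
       shift K (\<lambda>e. \<psi> ((0, 0), e)) e \<oplus>\<^bsub>K\<^esub> shift K (\<lambda>e. \<psi> ((1, 0), e)) e \<ominus>\<^bsub>K\<^esub> \<psi> ((0, 0), e)
     else \<psi> (x, e))"

definition untwist ::
    "('k, 'm) ring_scheme \<Rightarrow> ((nat \<times> nat) \<times> nat \<Rightarrow> 'k) \<Rightarrow> (nat \<times> nat) \<times> nat \<Rightarrow> 'k" where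
  "untwist K \<psi> = (\<lambda>(x, e).
     if x = (0, 0) then shift K (\<lambda>e. \<psi> ((0, 0), e)) e \<ominus>\<^bsub>K\<^esub> \<psi> ((1, 0), e)
     else if x = (1, 0) then
       \<psi> ((0, 0), e) \<oplus>\<^bsub>K\<^esub> \<psi> ((1, 0), e) \<ominus>\<^bsub>K\<^esub> shift K (\<lambda>e. \<psi> ((0, 0), e)) e
     else \<psi> (x, e))"

lemma filt_op_reindex: "cring K \<Longrightarrow> filt_op K (reindex K m \<sigma>)"
proof -
  assume "cring K"
  then interpret cring K .
  show ?thesis
    by (intro filt_opI filtI) (auto simp: reindex_def filt_carrier[of _ K 0] filt_carrier filt_zero split: prod.splits)
qed

section \<open>Multiplication by t and the twisting matrix\<close>

context cring
begin

lemma shift_carrier: "(\<And>e. f e \<in> carrier R) \<Longrightarrow> shift R f e \<in> carrier R"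
  by (cases e) auto

lemma shift_add: "(\<And>e. f e \<in> carrier R) \<Longrightarrow> (\<And>e. g e \<in> carrier R) \<Longrightarrow>
    shift R (\<lambda>e. f e \<oplus> g e) e = shift R f e \<oplus> shift R g e"
  by (cases e) auto

lemma shift_smult: "c \<in> carrier R \<Longrightarrow> shift R (\<lambda>e. c \<otimes> f e) e = c \<otimes> shift R f e"
  by (cases e) auto

text \<open>The matrix entries are polynomials in t, so divisibility by a power of t is
  kept.\<close>

lemma filt_op_twist: "filt_op R (twist R)"
proof (intro filt_opI filtI)
  fix n and \<psi> :: "(nat \<times> nat) \<times> nat \<Rightarrow> 'a" and i :: "nat \<times> nat" and e
  assume \<psi>: "\<psi> \<in> filt R n"
  then have c: "\<psi> x \<in> carrier R" for x by (rule filt_carrier)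
  show "twist R \<psi> (i, e) \<in> carrier R"
    using c by (simp add: twist_def shift_carrier)
  show "twist R \<psi> (i, e) = \<zero>" if "e < n"
    using that c filt_zero[OF \<psi>] by (cases e) (simp_all add: twist_def minus_eq)
next
  fix \<psi> \<phi> :: "(nat \<times> nat) \<times> nat \<Rightarrow> 'a" and x :: "(nat \<times> nat) \<times> nat"
  assume "\<psi> \<in> filt R 0" "\<phi> \<in> filt R 0"
  then have c: "\<psi> x \<in> carrier R" "\<phi> x \<in> carrier R" for x by (simp_all add: filt_carrier)
  obtain i e where x: "x = (i, e)" by fastforce
  have s: "shift R (\<lambda>e. \<psi> (i, e)) e \<in> carrier R" "shift R (\<lambda>e. \<phi> (i, e)) e \<in> carrier R" for i e
    by (auto intro!: shift_carrier c)
  show "twist R (\<lambda>x. \<psi> x \<oplus> \<phi> x) x = twist R \<psi> x \<oplus> twist R \<phi> x"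
    using c[of "((0,0),e)"] c[of "((1,0),e)"] s[of "(0,0)" e] s[of "(1,0)" e]
    by (simp add: twist_def x shift_add c minus_eq minus_add a_ac)
next
  fix a and \<psi> :: "(nat \<times> nat) \<times> nat \<Rightarrow> 'a" and x :: "(nat \<times> nat) \<times> nat"
  assume a: "a \<in> carrier R" and "\<psi> \<in> filt R 0"
  then have c: "\<psi> x \<in> carrier R" for x by (simp add: filt_carrier)
  obtain i e where x: "x = (i, e)" by fastforce
  have s: "shift R (\<lambda>e. \<psi> (i, e)) e \<in> carrier R" for i e
    by (auto intro!: shift_carrier c)
  show "twist R (\<lambda>x. a \<otimes> \<psi> x) x = a \<otimes> twist R \<psi> x"
    using a c s by (simp add: twist_def x shift_smult r_distr minus_eq r_minus)
qed

lemma filt_op_untwist: "filt_op R (untwist R)"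
proof (intro filt_opI filtI)
  fix n and \<psi> :: "(nat \<times> nat) \<times> nat \<Rightarrow> 'a" and i :: "nat \<times> nat" and e
  assume \<psi>: "\<psi> \<in> filt R n"
  then have c: "\<psi> x \<in> carrier R" for x by (rule filt_carrier)
  show "untwist R \<psi> (i, e) \<in> carrier R"
    using c by (simp add: untwist_def shift_carrier)
  show "untwist R \<psi> (i, e) = \<zero>" if "e < n"
    using that c filt_zero[OF \<psi>] by (cases e) (simp_all add: untwist_def minus_eq)
next
  fix \<psi> \<phi> :: "(nat \<times> nat) \<times> nat \<Rightarrow> 'a" and x :: "(nat \<times> nat) \<times> nat"
  assume "\<psi> \<in> filt R 0" "\<phi> \<in> filt R 0"
  then have c: "\<psi> x \<in> carrier R" "\<phi> x \<in> carrier R" for x by (simp_all add: filt_carrier)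
  obtain i e where x: "x = (i, e)" by fastforce
  have s: "shift R (\<lambda>e. \<psi> (i, e)) e \<in> carrier R" "shift R (\<lambda>e. \<phi> (i, e)) e \<in> carrier R" for i e
    by (auto intro!: shift_carrier c)
  show "untwist R (\<lambda>x. \<psi> x \<oplus> \<phi> x) x = untwist R \<psi> x \<oplus> untwist R \<phi> x"
    using c[of "((0,0),e)"] c[of "((1,0),e)"] s[of "(0,0)" e] s[of "(1,0)" e]
    by (simp add: untwist_def x shift_add c minus_eq minus_add a_ac)
next
  fix a and \<psi> :: "(nat \<times> nat) \<times> nat \<Rightarrow> 'a" and x :: "(nat \<times> nat) \<times> nat"
  assume a: "a \<in> carrier R" and "\<psi> \<in> filt R 0"
  then have c: "\<psi> x \<in> carrier R" for x by (simp add: filt_carrier)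
  obtain i e where x: "x = (i, e)" by fastforce
  have s: "shift R (\<lambda>e. \<psi> (i, e)) e \<in> carrier R" for i e
    by (auto intro!: shift_carrier c)
  show "untwist R (\<lambda>x. a \<otimes> \<psi> x) x = a \<otimes> untwist R \<psi> x"
    using a c s by (simp add: untwist_def x shift_smult r_distr minus_eq r_minus)
qed

lemma twist_untwist:
  assumes \<psi>: "\<psi> \<in> filt R 0"
  shows "twist R (untwist R \<psi>) = \<psi>" "untwist R (twist R \<psi>) = \<psi>"
proof -
  have c: "\<psi> x \<in> carrier R" for x using \<psi> by (rule filt_carrier)
  have "twist R (untwist R \<psi>) (i, e) = \<psi> (i, e) \<and> untwist R (twist R \<psi>) (i, e) = \<psi> (i, e)" for i e
  proof (cases e)
    case 0
    have *: "(\<zero> \<ominus> b) \<oplus> (a \<oplus> b \<ominus> \<zero>) = a" "\<zero> \<oplus> \<zero> \<ominus> (\<zero> \<ominus> b) = b"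
      "\<zero> \<ominus> (\<zero> \<oplus> \<zero> \<ominus> a) = a" "a \<oplus> b \<oplus> (\<zero> \<oplus> \<zero> \<ominus> a) \<ominus> \<zero> = b"
      if "a \<in> carrier R" "b \<in> carrier R" for a b
      using that by algebra+
    show ?thesis
      unfolding 0 twist_def untwist_def using *[OF c c] by simp
  next
    case (Suc k)
    \<comment> \<open>Here a, b are the coefficients of the two twisted coordinates at the current
      exponent, a', b' those one below. The variable \<open>t\<close> is not the indeterminate but
      the value produced by shifting the first coordinate twice.\<close>
    have *: "(a' \<ominus> b) \<oplus> (a \<oplus> b \<ominus> a') = a"
      "(t \<ominus> b') \<oplus> (a' \<oplus> b' \<ominus> t) \<ominus> (a' \<ominus> b) = b"
      "a' \<oplus> b' \<ominus> (a' \<oplus> b' \<ominus> a) = a"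
      "a \<oplus> b \<oplus> (a' \<oplus> b' \<ominus> a) \<ominus> (a' \<oplus> b') = b"
      if "a \<in> carrier R" "b \<in> carrier R" "a' \<in> carrier R" "b' \<in> carrier R" "t \<in> carrier R"
      for a b a' b' t
      using that by algebra+
    have "shift R (\<lambda>e. \<psi> ((0,0),e)) k \<in> carrier R"
      by (rule shift_carrier) (rule c)
    then show ?thesis
      unfolding Suc twist_def untwist_def using *[OF c c c c] by simp
  qed
  then show "twist R (untwist R \<psi>) = \<psi>" "untwist R (twist R \<psi>) = \<psi>"
    by auto
qed

end

section \<open>Permutations of coordinates and the twisted isomorphism\<close>

lemma bij_betw_countable_infinite:
  fixes A B :: "'a::countable set"
  assumes "infinite A" "infinite B"
  obtains f where "bij_betw f A B"
  using bij_betw_trans[OF to_nat_on_infinite[of A] bij_betw_from_nat_into[of B]] assms by auto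

lemma reindex_block_iso:
  assumes "cring K" and \<sigma>: "bij_betw \<sigma> ({..<m} \<times> UNIV) ({..<n} \<times> UNIV)"
  shows "block_iso K m n (reindex K m \<sigma>) (reindex K n (inv_into ({..<m} \<times> UNIV) \<sigma>))"
proof -
  let ?S = "{..<m} \<times> (UNIV :: nat set)" and ?\<tau> = "inv_into ({..<m} \<times> UNIV) \<sigma>"
  have 1: "fst (\<sigma> x) < n" "?\<tau> (\<sigma> x) = x" if "fst x < m" for x
  proof -
    have x: "x \<in> ?S" using that by (simp add: mem_Times_iff)
    then have "\<sigma> x \<in> {..<n} \<times> UNIV" using bij_betwE[OF \<sigma>] by blast
    then show "fst (\<sigma> x) < n" "?\<tau> (\<sigma> x) = x"
      using x \<sigma> by (simp_all add: mem_Times_iff bij_betw_inv_into_left)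
  qed
  have 2: "fst (?\<tau> y) < m" "\<sigma> (?\<tau> y) = y" if "fst y < n" for y
  proof -
    have y: "y \<in> {..<n} \<times> UNIV" using that by (simp add: mem_Times_iff)
    then have "?\<tau> y \<in> ?S" using bij_betwE[OF bij_betw_inv_into[OF \<sigma>]] by blast
    then show "fst (?\<tau> y) < m" "\<sigma> (?\<tau> y) = y"
      using y \<sigma> by (simp_all add: mem_Times_iff bij_betw_inv_into_right)
  qed
  show ?thesis
    unfolding block_iso_def using 1 2 filt_op_reindex[OF assms(1)]
    by (auto simp: reindex_def fun_eq_iff)
qed

text \<open>Any positive finite number of copies of the naturals is countably infinite, so a
  permutation of coordinates serves.\<close>

lemma ex_block_iso:
  assumes "cring K" "0 < m" "0 < n"
  shows "\<exists>A B. block_iso K m n A B"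
proof -
  have "infinite ({..<m} \<times> (UNIV :: nat set))" "infinite ({..<n} \<times> (UNIV :: nat set))"
    using assms by (auto simp: finite_cartesian_product_iff)
  then obtain \<sigma> where "bij_betw \<sigma> ({..<m} \<times> (UNIV :: nat set)) ({..<n} \<times> (UNIV :: nat set))"
    by (rule bij_betw_countable_infinite)
  then show ?thesis
    using reindex_block_iso[OF assms(1)] by blast
qed

text \<open>Off the twisted coordinates, summand 1 is sent into the complement of summand 1, so that the
  twist alone determines the (1, 1) blocks of the isomorphism below and of its inverse.\<close>

lemma ex_matching:
  assumes "2 \<le> m" "2 \<le> n"
  obtains \<sigma> :: "nat \<times> nat \<Rightarrow> nat \<times> nat"
  where "bij_betw \<sigma> ({..<m} \<times> UNIV) ({..<n} \<times> UNIV)"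
    and "\<sigma> (0, 0) = (0, 0)" "\<sigma> (1, 0) = (1, 0)" "\<And>a. fst (\<sigma> (1, Suc a)) \<noteq> 1"
proof -
  let ?C = "{(0, 0), (1, 0)} :: (nat \<times> nat) set" and ?D = "{1} \<times> {0<..} :: (nat \<times> nat) set"
  let ?E = "\<lambda>m. {..<m} \<times> UNIV - ?C - ?D :: (nat \<times> nat) set"
  have infE: "infinite (?E m)" if "2 \<le> m" for m
  proof (rule infinite_super)
    show "{0} \<times> {0<..} \<subseteq> ?E m" using that by auto
    show "infinite ({0} \<times> {0<..} :: (nat \<times> nat) set)"
      by (auto simp: finite_cartesian_product_iff infinite_Ioi)
  qed
  have infD: "infinite ?D"
    by (auto simp: finite_cartesian_product_iff infinite_Ioi)
  obtain f where f: "bij_betw f ?D (?E n)"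
    using infD infE[OF assms(2)] by (rule bij_betw_countable_infinite)
  obtain g where g: "bij_betw g (?E m) ?D"
    using infE[OF assms(1)] infD by (rule bij_betw_countable_infinite)
  \<comment> \<open>The twisted coordinates \<open>?C\<close> stay fixed. The rest \<open>?D\<close>
    of summand 1 goes onto everything else, and everything else onto \<open>?D\<close>; both are
    infinite, so no coordinate is left unmatched.\<close>
  define \<sigma> where "\<sigma> x = (if x \<in> ?C then x else if x \<in> ?D then f x else g x)" for x
  have "bij_betw \<sigma> ?C ?C \<longleftrightarrow> bij_betw id ?C ?C"
    by (rule bij_betw_cong) (simp add: \<sigma>_def)
  moreover have "bij_betw \<sigma> ?D (?E n) \<longleftrightarrow> bij_betw f ?D (?E n)"
    by (rule bij_betw_cong) (auto simp: \<sigma>_def)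
  moreover have "bij_betw \<sigma> (?E m) ?D \<longleftrightarrow> bij_betw g (?E m) ?D"
    by (rule bij_betw_cong) (auto simp: \<sigma>_def)
  ultimately have "bij_betw \<sigma> (?C \<union> (?D \<union> ?E m)) (?C \<union> (?E n \<union> ?D))"
    using f g by (intro bij_betw_combine) auto
  moreover have "?C \<union> (?D \<union> ?E m) = {..<m} \<times> UNIV" "?C \<union> (?E n \<union> ?D) = {..<n} \<times> UNIV"
    using assms by auto
  ultimately have "bij_betw \<sigma> ({..<m} \<times> UNIV) ({..<n} \<times> UNIV)"
    by simp
  moreover have "fst (\<sigma> (1, Suc a)) \<noteq> 1" for a
  proof
    assume a: "fst (\<sigma> (1, Suc a)) = 1"
    have "f (1, Suc a) \<in> ?E n"
      using bij_betwE[OF f] by auto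
    then show False
      using a by (cases "f (1, Suc a)"; cases "snd (f (1, Suc a))") (auto simp: \<sigma>_def)
  qed
  ultimately show thesis
    by (intro that[of \<sigma>]) (auto simp: \<sigma>_def)
qed

text \<open>Used in two ways: with positions as \<open>'i\<close> it projects to one summand, with
  vertices as \<open>'i\<close> it is the action of a vertex.\<close>

definition component ::
    "('k, 'm) ring_scheme \<Rightarrow> 'i \<Rightarrow> (('i \<times> nat) \<times> nat \<Rightarrow> 'k) \<Rightarrow> ('i \<times> nat) \<times> nat \<Rightarrow> 'k" where
  "component K i \<psi> = (\<lambda>((j, a), e). if j = i then \<psi> ((j, a), e) else \<zero>\<^bsub>K\<^esub>)"

lemma component_apply:
  "component K i \<psi> ((j, a), e) = (if j = i then \<psi> ((j, a), e) else \<zero>\<^bsub>K\<^esub>)"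
  by (simp add: component_def)

text \<open>Summand 1 is the second one, so this prescribes the action of h_22 h_22^* in terms of
  blocks, before any vertices are involved.\<close>

definition twisted ::
    "('k, 'm) ring_scheme \<Rightarrow>
     (((nat \<times> nat) \<times> nat \<Rightarrow> 'k) \<Rightarrow> ((nat \<times> nat) \<times> nat \<Rightarrow> 'k)) \<Rightarrow>
     (((nat \<times> nat) \<times> nat \<Rightarrow> 'k) \<Rightarrow> ((nat \<times> nat) \<times> nat \<Rightarrow> 'k)) \<Rightarrow> bool" where
  "twisted K A B \<longleftrightarrow> (\<forall>\<psi> \<in> filt K 0. \<forall>a e.
     A (component K 1 (B (component K 1 \<psi>))) ((1, a), e) =
       (if a = 0 then shift K (\<lambda>e. \<psi> ((1, 0), e)) e else \<zero>\<^bsub>K\<^esub>))"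

text \<open>\<open>A\<close> permutes coordinates and then twists on the m side; \<open>B\<close>
  undoes this in reverse order. As the permutation fixes (0, 0) and (1, 0), the twist meets the same
  two coordinates on both sides.\<close>

lemma ex_twisted_block_iso:
  fixes K (structure)
  assumes "cring K" "2 \<le> m" "2 \<le> n"
  shows "\<exists>A B. block_iso K m n A B \<and> twisted K A B"
proof -
  interpret cring K by fact
  \<comment> \<open>The matching runs from the n side to the m side because \<open>B\<close> pulls
    back along it; hence the two size hypotheses trade places.\<close>
  obtain \<sigma> :: "nat \<times> nat \<Rightarrow> nat \<times> nat"
    where \<sigma>: "bij_betw \<sigma> ({..<n} \<times> UNIV) ({..<m} \<times> UNIV)"
      and \<sigma>0: "\<sigma> (0, 0) = (0, 0)" and \<sigma>1: "\<sigma> (1, 0) = (1, 0)"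
      and \<sigma>_Suc: "\<And>a. fst (\<sigma> (1, Suc a)) \<noteq> 1"
    using ex_matching[OF assms(3,2)] by metis
  let ?\<tau> = "inv_into ({..<n} \<times> UNIV) \<sigma>"
  let ?P = "reindex K m ?\<tau>" and ?P' = "reindex K n \<sigma>"
  let ?A = "\<lambda>\<psi>. twist K (?P \<psi>)" and ?B = "\<lambda>\<psi>. ?P' (untwist K \<psi>)"
  have P: "block_iso K m n ?P ?P'"
    by (rule block_iso_sym[OF reindex_block_iso[OF assms(1) \<sigma>]])
  have \<tau>: "?\<tau> (\<sigma> x) = x" if "fst x < n" for x
    using that \<sigma> by (auto simp: bij_betw_inv_into_left mem_Times_iff)
  have \<sigma>_inj: "\<sigma> x = \<sigma> y \<Longrightarrow> x = y" if "fst x < n" "fst y < n" for x y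
    using \<tau> that by metis
  have \<tau>': "\<sigma> (?\<tau> y) = y" if "fst y < m" for y
    using that \<sigma> by (auto simp: bij_betw_inv_into_right mem_Times_iff)
  have "block_iso K m n ?A ?B"
    unfolding block_iso_def
  proof (intro conjI allI impI ballI)
    show "filt_op K ?A" "filt_op K ?B"
      by (rule filt_op_comp[OF filt_op_twist filt_op_reindex[OF assms(1)]]
          filt_op_comp[OF filt_op_reindex[OF assms(1)] filt_op_untwist])+
    show "?A \<psi> ((i, a), e) = \<zero>" if "m \<le> i" for \<psi> i a e
      using that assms(2) by (simp add: twist_def reindex_def)
    show "?B \<psi> ((j, b), e) = \<zero>" if "n \<le> j" for \<psi> j b e
      using that by (simp add: reindex_def)
    show "?A (?B \<psi>) = \<psi>" if \<psi>: "\<psi> \<in> filt K 0" and supp: "\<forall>i a e. m \<le> i \<longrightarrow> \<psi> ((i, a), e) = \<zero>" for \<psi>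
    proof -
      have "untwist K \<psi> \<in> filt K 0"
        using filt_op_closed[OF filt_op_untwist \<psi>] .
      moreover have "\<forall>i a e. m \<le> i \<longrightarrow> untwist K \<psi> ((i, a), e) = \<zero>"
        using supp assms(2) by (auto simp: untwist_def)
      ultimately have "?P (?P' (untwist K \<psi>)) = untwist K \<psi>"
        using P unfolding block_iso_def by blast
      then show ?thesis
        by (simp add: twist_untwist \<psi>)
    qed
    show "?B (?A \<psi>) = \<psi>" if \<psi>: "\<psi> \<in> filt K 0" and supp: "\<forall>i a e. n \<le> i \<longrightarrow> \<psi> ((i, a), e) = \<zero>" for \<psi>
    proof -
      have "?P \<psi> \<in> filt K 0"
        using filt_op_closed[OF filt_op_reindex[OF assms(1)] \<psi>] .
      then have "?B (?A \<psi>) = ?P' (?P \<psi>)"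
        by (simp add: twist_untwist)
      also have "\<dots> = \<psi>"
        using P \<psi> supp unfolding block_iso_def by blast
      finally show ?thesis .
    qed
  qed
  moreover have "?A (component K 1 (?B (component K 1 \<psi>))) ((1, a), e) =
      (if a = 0 then shift K (\<lambda>e. \<psi> ((1, 0), e)) e else \<zero>)"
    if \<psi>: "\<psi> \<in> filt K 0" for \<psi> a e
  proof -
    have c: "\<psi> x \<in> carrier K" for x using \<psi> by (rule filt_carrier)
    have sh0: "shift K (\<lambda>e. \<zero>) e = \<zero>" for e by (cases e) auto
    define Y where "Y = component K 1 (?B (component K 1 \<psi>))"
    have Y0: "Y (x, e) = \<zero>" if "x \<noteq> (1, 0)" for x e
    proof (cases "fst x = 1")
      case False
      then show ?thesis by (auto simp: Y_def component_def split: prod.splits)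
    next
      case True
      then obtain b where x: "x = (1, Suc b)"
        using \<open>x \<noteq> (1, 0)\<close> by (cases x; cases "snd x") auto
      \<comment> \<open>\<open>untwist\<close> spills the value at (1, 0) into (0, 0), so leaving
        summand 1 is not enough: injectivity keeps \<sigma> off (0, 0) as well.\<close>
      have "\<sigma> (1, Suc b) \<noteq> (0, 0)" "\<sigma> (1, Suc b) \<noteq> (1, 0)"
        using \<sigma>_inj[of "(1, Suc b)" "(0, 0)"] \<sigma>_inj[of "(1, Suc b)" "(1, 0)"] \<sigma>0 \<sigma>1 assms(3) by auto
      then have "untwist K (component K 1 \<psi>) (\<sigma> (1, Suc b), e) = \<zero>"
        using \<sigma>_Suc[of b] by (cases "\<sigma> (1, Suc b)") (auto simp: untwist_def component_def)
      then show ?thesis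
        by (simp add: Y_def x component_apply reindex_def)
    qed
    \<comment> \<open>The lower right entry of the inverse matrix is 1.\<close>
    have "untwist K (component K 1 \<psi>) ((1, 0), e) = \<psi> ((1, 0), e)" for e
      using c by (simp add: untwist_def component_def sh0 minus_eq)
    then have Y1: "Y ((1, 0), e) = \<psi> ((1, 0), e)" for e
      using \<sigma>1 assms(3) by (simp add: Y_def component_apply reindex_def)
    have \<tau>10: "?\<tau> (1, 0) = (1, 0)" "?\<tau> (0, 0) = (0, 0)"
      using \<tau>[of "(1, 0)"] \<tau>[of "(0, 0)"] \<sigma>0 \<sigma>1 assms(3) by auto
    have "?P Y ((1, 0), e) = \<psi> ((1, 0), e)" "?P Y ((0, 0), e) = \<zero>" for e
      using assms(2) Y0[of "(0, 0)"] Y1 \<tau>10 by (simp_all add: reindex_def)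
    moreover have "?P Y ((1, Suc a), e) = \<zero>" for a e
    proof -
      have "?\<tau> (1, Suc a) \<noteq> (1, 0)"
        using \<tau>'[of "(1, Suc a)"] \<sigma>1 assms(2) by auto
      then show ?thesis
        using Y0 by (simp add: reindex_def)
    qed
    moreover have "shift K (\<lambda>e. \<psi> ((1, 0), e)) e \<in> carrier K"
      by (rule shift_carrier) (rule c)
    \<comment> \<open>The lower right entry t of the matrix supplies the shift.\<close>
    ultimately have "?A Y ((1, a), e) = (if a = 0 then shift K (\<lambda>e. \<psi> ((1, 0), e)) e else \<zero>)"
      by (cases a) (simp_all add: twist_def sh0 minus_eq)
    then show ?thesis
      by (simp add: Y_def)
  qed
  ultimately show ?thesis
    unfolding twisted_def by blast
qed

section \<open>The module over the Leavitt path algebra\<close>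

text \<open>A listing may repeat a vertex, so summands are indexed by positions. \<open>slot\<close>
  copies the vector at a vertex into one position, and \<open>unslot\<close> copies one position
  back to a vertex.\<close>

definition slot ::
    "('k, 'm) ring_scheme \<Rightarrow> 'v \<Rightarrow> nat \<Rightarrow> (('v \<times> nat) \<times> nat \<Rightarrow> 'k) \<Rightarrow> (nat \<times> nat) \<times> nat \<Rightarrow> 'k" where
  "slot K v i \<psi> = (\<lambda>((j, a), e). if j = i then \<psi> ((v, a), e) else \<zero>\<^bsub>K\<^esub>)"

definition unslot ::
    "('k, 'm) ring_scheme \<Rightarrow> 'v \<Rightarrow> nat \<Rightarrow> ((nat \<times> nat) \<times> nat \<Rightarrow> 'k) \<Rightarrow> ('v \<times> nat) \<times> nat \<Rightarrow> 'k" where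
  "unslot K v i \<psi> = (\<lambda>((u, a), e). if u = v then \<psi> ((i, a), e) else \<zero>\<^bsub>K\<^esub>)"

text \<open>Distinct positions give zero even when they carry the same vertex; this is the source of
  \<delta>_ij in the sum relations.\<close>

lemma slot_simps:
  "slot K v i (unslot K v i \<psi>') = component K i \<psi>'"
  "slot K v i (component K v \<psi>) = slot K v i \<psi>"
  "component K v (unslot K v i \<psi>') = unslot K v i \<psi>'"
  "unslot K v i (slot K v i \<psi>) = component K v \<psi>"
  "i \<noteq> j \<Longrightarrow> unslot K v i (slot K u j \<psi>) = (\<lambda>_. \<zero>\<^bsub>K\<^esub>)"
  "component K i (slot K v i \<psi>) = slot K v i \<psi>"
  by (auto simp: slot_def unslot_def component_def fun_eq_iff)

context cring
begin

lemma filt_op_component: "filt_op R (component R v)"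
  by (intro filt_opI filtI) (auto simp: component_def filt_carrier filt_zero split: prod.splits)

lemma filt_op_slot: "filt_op R (slot R v i)"
  by (intro filt_opI filtI) (auto simp: slot_def filt_carrier filt_zero split: prod.splits)

lemma filt_op_unslot: "filt_op R (unslot R v i)"
  by (intro filt_opI filtI) (auto simp: unslot_def filt_carrier filt_zero split: prod.splits)

lemma finsum_component:
  fixes \<psi> :: "(nat \<times> nat) \<times> nat \<Rightarrow> 'a"
  assumes \<psi>: "\<psi> \<in> filt R 0" and supp: "\<And>j b e. n \<le> j \<Longrightarrow> \<psi> ((j, b), e) = \<zero>"
  shows "(\<lambda>x. \<Oplus>k \<in> {..<n}. component R k \<psi> x) = \<psi>"
proof
  fix x :: "(nat \<times> nat) \<times> nat"
  obtain j b e where x: "x = ((j, b), e)" by (metis prod.collapse)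
  have c: "\<psi> x \<in> carrier R" using \<psi> by (rule filt_carrier)
  show "(\<Oplus>k \<in> {..<n}. component R k \<psi> x) = \<psi> x"
  proof (cases "j < n")
    case True
    then show ?thesis
      using c add.finprod_singleton[of j "{..<n}" "\<lambda>_. \<psi> ((j, b), e)"] by (simp add: x component_apply)
  next
    case False
    have "(\<Oplus>k \<in> {..<n}. component R k \<psi> x) = \<zero>"
      using False by (intro add.finprod_one_eqI) (auto simp: x component_apply)
    then show ?thesis
      using False supp by (simp add: x)
  qed
qed

text \<open>Block (i, k) of \<open>A\<close> times block (k, j) of \<open>B\<close>, summed over k,
  is block (i, j) of the composite. The detour through the copy at \<open>r k\<close> is harmless,
  since \<open>unslot\<close> followed by \<open>slot\<close> is the projection to summand
  k.\<close>

lemma block_iso_sum: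
  assumes AB: "block_iso R m n A B" and j: "j < m" and \<psi>: "\<psi> \<in> filt R 0"
  shows "(\<Oplus>k \<in> {..<n}. unslot R v i (A (slot R (r k) k (unslot R (r k) k (B (slot R u j \<psi>))))) x) =
    unslot R v i (slot R u j \<psi>) x"
proof -
  have A: "filt_op R A" and B: "filt_op R B"
    using AB by (auto simp: block_iso_def)
  let ?\<phi> = "slot R u j \<psi>"
  have \<phi>: "?\<phi> \<in> filt R 0"
    using filt_op_closed[OF filt_op_slot \<psi>] .
  then have B\<phi>: "B ?\<phi> \<in> filt R 0"
    by (rule filt_op_closed[OF B])
  have "(\<lambda>x. \<Oplus>k \<in> {..<n}. unslot R v i (A (component R k (B ?\<phi>))) x) =
      unslot R v i (A (\<lambda>x. \<Oplus>k \<in> {..<n}. component R k (B ?\<phi>) x))"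
    using filt_op_closed[OF filt_op_component B\<phi>]
    by (intro filt_op_finsum[OF filt_op_comp[OF filt_op_unslot A], symmetric]) auto
  also have "(\<lambda>x. \<Oplus>k \<in> {..<n}. component R k (B ?\<phi>) x) = B ?\<phi>"
    using AB B\<phi> by (intro finsum_component) (auto simp: block_iso_def)
  also have "\<forall>i a e. m \<le> i \<longrightarrow> ?\<phi> ((i, a), e) = \<zero>"
    using j by (auto simp: slot_def)
  then have "A (B ?\<phi>) = ?\<phi>"
    using AB \<phi> unfolding block_iso_def by blast
  finally have "(\<Oplus>k \<in> {..<n}. unslot R v i (A (component R k (B ?\<phi>))) x) = unslot R v i ?\<phi> x"
    by (rule fun_cong)
  then show ?thesis
    by (simp add: slot_simps)
qed

end

text \<open>\<open>Edge h i j\<close> is a block of \<open>A h\<close>, from the copy at a range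
  vertex to the copy at a source vertex: in a left module the right factor acts first, so an edge
  acts from its range to its source.\<close>

fun gen_op ::
    "('k, 'm) ring_scheme \<Rightarrow> ('e \<Rightarrow> 'v list) \<Rightarrow> ('e \<Rightarrow> 'v list) \<Rightarrow>
     ('e \<Rightarrow> ((nat \<times> nat) \<times> nat \<Rightarrow> 'k) \<Rightarrow> (nat \<times> nat) \<times> nat \<Rightarrow> 'k) \<Rightarrow>
     ('e \<Rightarrow> ((nat \<times> nat) \<times> nat \<Rightarrow> 'k) \<Rightarrow> (nat \<times> nat) \<times> nat \<Rightarrow> 'k) \<Rightarrow>
     ('v, 'e) lpa_gen \<Rightarrow> (('v \<times> nat) \<times> nat \<Rightarrow> 'k) \<Rightarrow> ('v \<times> nat) \<times> nat \<Rightarrow> 'k" where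
  "gen_op K sl rl A B (Vert v) = component K v"
| "gen_op K sl rl A B (Edge h i j) = (\<lambda>\<psi>. unslot K (sl h ! i) i (A h (slot K (rl h ! j) j \<psi>)))"
| "gen_op K sl rl A B (Ghost h i j) = (\<lambda>\<psi>. unslot K (rl h ! j) j (B h (slot K (sl h ! i) i \<psi>)))"

locale lpa_rep = cring K + hypergraph H
  for K :: "('k, 'm) ring_scheme" (structure) and H :: "('v, 'e) pre_hypergraph" +
  fixes sl rl :: "'e \<Rightarrow> 'v list"
    and A B :: "'e \<Rightarrow> ((nat \<times> nat) \<times> nat \<Rightarrow> 'k) \<Rightarrow> (nat \<times> nat) \<times> nat \<Rightarrow> 'k"
  assumes listing: "hypergraph_listing H sl rl"
    and iso: "h \<in> hedges H \<Longrightarrow> block_iso K (size (hsource H h)) (size (hrange H h)) (A h) (B h)"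
begin

lemma filt_op_A: "h \<in> hedges H \<Longrightarrow> filt_op K (A h)"
  and filt_op_B: "h \<in> hedges H \<Longrightarrow> filt_op K (B h)"
  using iso by (auto simp: block_iso_def)

sublocale filtered_action K "lpa_gens H" "gen_op K sl rl A B"
proof
  fix x assume x: "x \<in> lpa_gens H"
  show "filt_op K (gen_op K sl rl A B x)"
  proof (cases x)
    case (Vert v)
    then show ?thesis by (simp add: filt_op_component)
  next
    case (Edge h i j)
    then have "h \<in> hedges H" using x by (auto simp: lpa_gens_def)
    then show ?thesis
      unfolding Edge gen_op.simps
      by (intro filt_op_comp[OF filt_op_unslot filt_op_comp[OF filt_op_A filt_op_slot]])
  next
    case (Ghost h i j)
    then have "h \<in> hedges H" using x by (auto simp: lpa_gens_def)
    then show ?thesis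
      unfolding Ghost gen_op.simps
      by (intro filt_op_comp[OF filt_op_unslot filt_op_comp[OF filt_op_B filt_op_slot]])
  qed
qed

lemma Vert_gens: "v \<in> hverts H \<Longrightarrow> Vert v \<in> lpa_gens H"
  by (simp add: lpa_gens_def)

lemma listed_verts:
  assumes "h \<in> hedges H"
  shows "i < size (hsource H h) \<Longrightarrow> sl h ! i \<in> hverts H"
    and "j < size (hrange H h) \<Longrightarrow> rl h ! j \<in> hverts H"
proof -
  have m: "mset (sl h) = hsource H h" "mset (rl h) = hrange H h"
    using listing assms by (auto simp: hypergraph_listing_def)
  show "sl h ! i \<in> hverts H" if "i < size (hsource H h)"
    using that source_verts[OF assms] nth_mem[of i "sl h"]
    by (auto simp: m(1)[symmetric])
  show "rl h ! j \<in> hverts H" if "j < size (hrange H h)"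
    using that range_verts[OF assms] nth_mem[of j "rl h"]
    by (auto simp: m(2)[symmetric])
qed

lemma edge_gens:
  assumes "h \<in> hedges H" "i < size (hsource H h)" "j < size (hrange H h)"
  shows "Edge h i j \<in> lpa_gens H" "Ghost h i j \<in> lpa_gens H"
  using assms by (simp_all add: lpa_gens_def)

abbreviation gen where "gen \<equiv> free_gen K"

section \<open>Verification of the defining relations\<close>

lemma act_gen_mult:
  assumes "x \<in> lpa_gens H" "y \<in> lpa_gens H" "\<psi> \<in> filt K 0"
  shows "act (gen x \<otimes>\<^bsub>F\<^esub> gen y) \<psi> = gen_op K sl rl A B x (gen_op K sl rl A B y \<psi>)"
  using assms filt_op_closed[OF filt_op_gen[OF assms(2)] assms(3)]
  by (simp add: act_mult act_gen free_gen_carrier)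

lemma act_zero': "act \<zero>\<^bsub>F\<^esub> \<psi> = (\<lambda>_. \<zero>)"
  by (rule ext) (rule act_zero)

text \<open>This is \<open>A h\<close> after \<open>B h\<close> being the identity, read block by
  block.\<close>

lemma act_edge_ghost:
  assumes h: "h \<in> hedges H" and i: "i < size (hsource H h)" and j: "j < size (hsource H h)"
    and \<psi>: "\<psi> \<in> filt K 0"
  shows "act (\<Oplus>\<^bsub>F\<^esub>k \<in> {..<size (hrange H h)}. gen (Edge h i k) \<otimes>\<^bsub>F\<^esub> gen (Ghost h j k)) \<psi> =
    act (if i = j then gen (Vert (sl h ! i)) else \<zero>\<^bsub>F\<^esub>) \<psi>"
proof
  fix x
  have "act (\<Oplus>\<^bsub>F\<^esub>k \<in> {..<size (hrange H h)}. gen (Edge h i k) \<otimes>\<^bsub>F\<^esub> gen (Ghost h j k)) \<psi> x =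
      (\<Oplus>k \<in> {..<size (hrange H h)}. act (gen (Edge h i k) \<otimes>\<^bsub>F\<^esub> gen (Ghost h j k)) \<psi> x)"
    using h i j \<psi> by (intro act_finsum free_alg_mult_closed free_gen_carrier edge_gens) auto
  also have "\<dots> = (\<Oplus>k \<in> {..<size (hrange H h)}. unslot K (sl h ! i) i (A h (slot K (rl h ! k) k
      (unslot K (rl h ! k) k (B h (slot K (sl h ! j) j \<psi>))))) x)"
  proof (rule finsum_cong')
    fix k assume "k \<in> {..<size (hrange H h)}"
    then show "act (gen (Edge h i k) \<otimes>\<^bsub>F\<^esub> gen (Ghost h j k)) \<psi> x =
        unslot K (sl h ! i) i (A h (slot K (rl h ! k) k
          (unslot K (rl h ! k) k (B h (slot K (sl h ! j) j \<psi>))))) x"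
      using act_gen_mult[OF edge_gens(1)[OF h i] edge_gens(2)[OF h j] \<psi>] by simp
  next
    show "(\<lambda>k. unslot K (sl h ! i) i (A h (slot K (rl h ! k) k
        (unslot K (rl h ! k) k (B h (slot K (sl h ! j) j \<psi>))))) x)
      \<in> {..<size (hrange H h)} \<rightarrow> carrier K"
      by (intro funcsetI filt_carrier[of _ _ 0] filt_op_closed[OF filt_op_unslot]
          filt_op_closed[OF filt_op_A[OF h]] filt_op_closed[OF filt_op_slot]
          filt_op_closed[OF filt_op_B[OF h]] \<psi>)
  qed simp
  also have "\<dots> = unslot K (sl h ! i) i (slot K (sl h ! j) j \<psi>) x"
    by (rule block_iso_sum[OF iso[OF h] j \<psi>])
  also have "\<dots> = act (if i = j then gen (Vert (sl h ! i)) else \<zero>\<^bsub>F\<^esub>) \<psi> x"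
    using Vert_gens[OF listed_verts(1)[OF h i]] \<psi>
    by (auto simp: slot_simps act_gen act_zero')
  finally show "act (\<Oplus>\<^bsub>F\<^esub>k \<in> {..<size (hrange H h)}. gen (Edge h i k) \<otimes>\<^bsub>F\<^esub> gen (Ghost h j k)) \<psi> x =
    act (if i = j then gen (Vert (sl h ! i)) else \<zero>\<^bsub>F\<^esub>) \<psi> x" .
qed

text \<open>The mirror image: \<open>block_iso_sym\<close> exchanges \<open>A h\<close> and
  \<open>B h\<close>.\<close>

lemma act_ghost_edge:
  assumes h: "h \<in> hedges H" and i: "i < size (hrange H h)" and j: "j < size (hrange H h)"
    and \<psi>: "\<psi> \<in> filt K 0"
  shows "act (\<Oplus>\<^bsub>F\<^esub>k \<in> {..<size (hsource H h)}. gen (Ghost h k i) \<otimes>\<^bsub>F\<^esub> gen (Edge h k j)) \<psi> =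
    act (if i = j then gen (Vert (rl h ! i)) else \<zero>\<^bsub>F\<^esub>) \<psi>"
proof
  fix x
  have "act (\<Oplus>\<^bsub>F\<^esub>k \<in> {..<size (hsource H h)}. gen (Ghost h k i) \<otimes>\<^bsub>F\<^esub> gen (Edge h k j)) \<psi> x =
      (\<Oplus>k \<in> {..<size (hsource H h)}. act (gen (Ghost h k i) \<otimes>\<^bsub>F\<^esub> gen (Edge h k j)) \<psi> x)"
    using h i j \<psi> by (intro act_finsum free_alg_mult_closed free_gen_carrier edge_gens) auto
  also have "\<dots> = (\<Oplus>k \<in> {..<size (hsource H h)}. unslot K (rl h ! i) i (B h (slot K (sl h ! k) k
      (unslot K (sl h ! k) k (A h (slot K (rl h ! j) j \<psi>))))) x)"
  proof (rule finsum_cong')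
    fix k assume "k \<in> {..<size (hsource H h)}"
    then show "act (gen (Ghost h k i) \<otimes>\<^bsub>F\<^esub> gen (Edge h k j)) \<psi> x =
        unslot K (rl h ! i) i (B h (slot K (sl h ! k) k
          (unslot K (sl h ! k) k (A h (slot K (rl h ! j) j \<psi>))))) x"
      using act_gen_mult[OF edge_gens(2)[OF h _ i] edge_gens(1)[OF h _ j] \<psi>] by simp
  next
    show "(\<lambda>k. unslot K (rl h ! i) i (B h (slot K (sl h ! k) k
        (unslot K (sl h ! k) k (A h (slot K (rl h ! j) j \<psi>))))) x)
      \<in> {..<size (hsource H h)} \<rightarrow> carrier K"
      by (intro funcsetI filt_carrier[of _ _ 0] filt_op_closed[OF filt_op_unslot]
          filt_op_closed[OF filt_op_A[OF h]] filt_op_closed[OF filt_op_slot]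
          filt_op_closed[OF filt_op_B[OF h]] \<psi>)
  qed simp
  also have "\<dots> = unslot K (rl h ! i) i (slot K (rl h ! j) j \<psi>) x"
    by (rule block_iso_sum[OF block_iso_sym[OF iso[OF h]] j \<psi>])
  also have "\<dots> = act (if i = j then gen (Vert (rl h ! i)) else \<zero>\<^bsub>F\<^esub>) \<psi> x"
    using Vert_gens[OF listed_verts(2)[OF h i]] \<psi>
    by (auto simp: slot_simps act_gen act_zero')
  finally show "act (\<Oplus>\<^bsub>F\<^esub>k \<in> {..<size (hsource H h)}. gen (Ghost h k i) \<otimes>\<^bsub>F\<^esub> gen (Edge h k j)) \<psi> x =
    act (if i = j then gen (Vert (rl h ! i)) else \<zero>\<^bsub>F\<^esub>) \<psi> x" .
qed

text \<open>The relations between vertices and edges or ghosts hold because \<open>slot\<close>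
  reads from one vertex only and \<open>unslot\<close> writes to one vertex only, so the adjacent
  projection is absorbed.\<close>

lemma act_lpa_rels:
  assumes "(l, r) \<in> lpa_rels K H sl rl" and \<psi>: "\<psi> \<in> filt K 0"
  shows "act l \<psi> = act r \<psi>"
  using assms(1)
proof cases
  case (vertices u v)
  then show ?thesis
    using \<psi> by (auto simp: act_gen_mult act_gen act_zero' Vert_gens)
      (auto simp: component_def fun_eq_iff)
next
  case (source_edge h i j)
  then show ?thesis
    using \<psi> by (simp add: act_gen_mult act_gen Vert_gens listed_verts edge_gens slot_simps)
next
  case (edge_range h i j)
  then show ?thesis
    using \<psi> by (simp add: act_gen_mult act_gen Vert_gens listed_verts edge_gens slot_simps)
next
  case (range_ghost h i j)
  then show ?thesis
    using \<psi> by (simp add: act_gen_mult act_gen Vert_gens listed_verts edge_gens slot_simps)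
next
  case (ghost_source h i j)
  then show ?thesis
    using \<psi> by (simp add: act_gen_mult act_gen Vert_gens listed_verts edge_gens slot_simps)
next
  case (edge_ghost h i j)
  then show ?thesis using act_edge_ghost \<psi> by simp
next
  case (ghost_edge h i j)
  then show ?thesis using act_ghost_edge \<psi> by simp
qed

lemma lpa_rels_carrier:
  assumes "(l, r) \<in> lpa_rels K H sl rl"
  shows "l \<in> carrier F \<and> r \<in> carrier F"
proof -
  interpret FA: abelian_group F by (rule free_alg_abelian_group)
  note [intro!] = FA.finsum_closed free_alg_mult_closed free_gen_carrier Vert_gens edge_gens
  show ?thesis
    using assms by cases (auto simp: listed_verts)
qed

end

section \<open>The element that raises the filtration\<close>

context lpa_rep
begin

text \<open>This is p: with indices starting at 0, position 1 is the second.\<close>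

definition corner :: "'e \<Rightarrow> ('v, 'e) lpa_gen list \<Rightarrow> 'k" where
  "corner h = gen (Edge h 1 1) \<otimes>\<^bsub>F\<^esub> gen (Ghost h 1 1)"

lemma corner_carrier:
  assumes "h \<in> hedges H" "2 \<le> size (hsource H h)" "2 \<le> size (hrange H h)"
  shows "corner h \<in> carrier F"
  using assms unfolding corner_def by (intro free_alg_mult_closed free_gen_carrier edge_gens) auto

lemma act_corner:
  assumes h: "h \<in> hedges H" and size: "2 \<le> size (hsource H h)" "2 \<le> size (hrange H h)"
    and twisted: "twisted K (A h) (B h)"
    and \<psi>: "\<psi> \<in> filt K 0"
  shows "act (corner h) \<psi> ((v, a), e) =
    (if v = sl h ! 1 \<and> a = 0 then shift K (\<lambda>e. \<psi> ((sl h ! 1, 0), e)) e else \<zero>)"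
proof -
  let ?s = "sl h ! 1"
  have "act (corner h) \<psi> = unslot K ?s 1 (A h (component K 1 (B h (slot K ?s 1 \<psi>))))"
    using h size \<psi> by (simp add: corner_def act_gen_mult edge_gens slot_simps del: One_nat_def)
  moreover have "A h (component K 1 (B h (slot K ?s 1 \<psi>))) ((1, a), e) =
      (if a = 0 then shift K (\<lambda>e. slot K ?s 1 \<psi> ((1, 0), e)) e else \<zero>)" for a e
    \<comment> \<open>\<open>twisted\<close> is applied to a family already concentrated in summand
      1, on which the inner \<open>component\<close> does nothing.\<close>
    using bspec[OF twisted[unfolded twisted_def] filt_op_closed[OF filt_op_slot \<psi>, of ?s 1]]
    by (simp add: slot_simps del: One_nat_def)
  ultimately show ?thesis
    by (simp add: unslot_def slot_def)
qed

lemma lpa_infinite_descent: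
  assumes "field K"
    and h: "h \<in> hedges H" and size: "2 \<le> size (hsource H h)" "2 \<le> size (hrange H h)"
    and twisted: "twisted K (A h) (B h)"
  defines "L \<equiv> leavitt_path_alg K H sl rl"
  shows "\<not> vectorspace.fin_dim K L \<and> \<not> simple_alg K L \<and> infinite {J. alg_ideal K L J} \<and>
    \<not> left_artinian_alg K L \<and> \<not> right_artinian_alg K L \<and> \<not> von_neumann_regular L"
  unfolding L_def leavitt_path_alg_def
proof (rule presented_alg_infinite_descent)
  interpret field K by fact
  let ?s = "sl h ! 1"
  note corner = act_corner[OF h size twisted]
  show "corner h \<in> carrier F"
    using h size by (rule corner_carrier)
  show "act (corner h) \<psi> \<in> filt K (Suc n)" if \<psi>: "\<psi> \<in> filt K n" for n \<psi>
  proof (rule filtI)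
    fix x :: "'v \<times> nat" and e
    obtain v a where x: "x = (v, a)" by fastforce
    have shift: "shift K (\<lambda>e. \<psi> ((?s, 0), e)) e \<in> carrier K"
      by (rule shift_carrier) (rule filt_carrier[OF \<psi>])
    show "act (corner h) \<psi> (x, e) \<in> carrier K"
      using shift by (simp add: x corner[OF filt_0[OF \<psi>]])
    show "act (corner h) \<psi> (x, e) = \<zero>" if "e < Suc n"
      using that filt_zero[OF \<psi>] by (cases e) (simp_all add: x corner[OF filt_0[OF \<psi>]])
  qed
  \<comment> \<open>The constant series 1 in the one coordinate that p multiplies by t, so the n-th
    power of p turns it into t^n.\<close>
  let ?\<psi> = "\<lambda>((v, a), e). if v = ?s \<and> a = 0 \<and> e = 0 then \<one> else \<zero>"
  show \<psi>: "?\<psi> \<in> filt K 0"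
    by (auto simp: filt_def)
  show "(act (corner h) ^^ n) ?\<psi> \<notin> filt K (Suc n)" for n
  proof -
    \<comment> \<open>The coefficient of t^n is 1, which excludes divisibility by t^(n+1).
      Membership in \<open>filt K 0\<close> is carried along because the formula for p is available
      only there.\<close>
    have "(act (corner h) ^^ n) ?\<psi> \<in> filt K 0 \<and> (act (corner h) ^^ n) ?\<psi> ((?s, 0), n) = \<one>"
    proof (induction n)
      case 0
      then show ?case using \<psi> by simp
    next
      case (Suc n)
      moreover have "corner h \<in> carrier F"
        using h size by (rule corner_carrier)
      ultimately show ?case
        by (simp add: corner act_filt)
    qed
    then show ?thesis
      using filt_zero[of _ K "Suc n" n] one_not_zero by fastforce
  qed
qed (use assms act_lpa_rels lpa_rels_carrier in blast)+

end

theorem theorem58: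
  fixes K :: "('k, 'm) ring_scheme"
    and H :: "('v, 'e) pre_hypergraph"
    and sl rl :: "'e \<Rightarrow> 'v list"
  assumes "field K"
    and "hypergraph H"
    and "hypergraph_listing H sl rl"
    and "\<exists>h \<in> hedges H. size (hsource H h) \<ge> 2 \<and> size (hrange H h) \<ge> 2"
  defines "L \<equiv> leavitt_path_alg K H sl rl"
  shows "\<not> vectorspace.fin_dim K L
    \<and> \<not> simple_alg K L
    \<and> infinite {J. alg_ideal K L J}
    \<and> \<not> left_artinian_alg K L
    \<and> \<not> right_artinian_alg K L
    \<and> \<not> von_neumann_regular L"
proof -
  interpret field K by fact
  interpret hypergraph H by fact
  have "cring K" ..
  obtain h0 where h0: "h0 \<in> hedges H" "2 \<le> size (hsource H h0)" "2 \<le> size (hrange H h0)"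
    using assms(4) by blast
  obtain A0 B0 where iso0: "block_iso K (size (hsource H h0)) (size (hrange H h0)) A0 B0"
    and twisted: "twisted K A0 B0"
    using ex_twisted_block_iso[OF \<open>cring K\<close> h0(2,3)] by blast
  \<comment> \<open>The premise stands inside the existential so that choice yields functions
    defined for every h.\<close>
  have "\<exists>A B. h \<in> hedges H \<longrightarrow> block_iso K (size (hsource H h)) (size (hrange H h)) A B" for h
    using ex_block_iso[OF \<open>cring K\<close>, of "size (hsource H h)" "size (hrange H h)"]
      source_nonempty[of h] range_nonempty[of h] by (auto simp: nonempty_has_size)
  then obtain A B where iso: "\<And>h. h \<in> hedges H \<Longrightarrow>
      block_iso K (size (hsource H h)) (size (hrange H h)) (A h) (B h)"
    by metis
  \<comment> \<open>Since p involves h0 alone, only the isomorphism at h0 is replaced by the twisted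
    one.\<close>
  interpret lpa_rep K H sl rl "A(h0 := A0)" "B(h0 := B0)"
    by unfold_locales (use assms(3) iso iso0 in auto)
  show ?thesis
    unfolding L_def
    by (rule lpa_infinite_descent[OF assms(1) h0]) (use twisted in simp)
qed

end
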